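(* Let $M\ge 2$ be an integer. Let $X=(X(t))_{t\in\mathbb{R}}$ be a real, centred, second-order wide-sense stationary random process, continuous in quadratic mean. Assume that the spectrum $\gamma$ of $X$ belongs to $L^{\infty}(\mathbb{R})$ and is supported within $[-\pi,\pi]$. For each order $r\in\mathbb{N}$ let $(h^{[r]}_m)_{0\le m\le M-1}$ be a family of real paraunitary $M$-band filters with frequency responses $H^{[r]}_m$ such that, for every $m\in\{0,\ldots,M-1\}$, $$\lim_{r\to\infty}H^{[r]}_m=H^{S}_m\quad\text{almost everywhere},$$ where $H^S_m$ are the Shannon filters. For every natural number $j$ and every $n\in\{0,1,\ldots,M^j-1\}$, let $R^{[r]}_{j,n}$ (resp. $R^{S}_{j,n}$) be the autocorrelation function of the wavelet packet coefficients of $X$ at node $(j,n)$ of the $M$-band wavelet packet decomposition of the Paley–Wiener space (functions of $L^2(\mathbb{R})$ with Fourier transform supported in $[-\pi,\pi]$) achieved with the filters $h^{[r]}_m$ (resp. with the Shannon filters). Then, for every natural number $j$, $$\lim_{r\to+\infty}R^{[r]}_{j,n}[k]=R^{S}_{j,n}[k],$$ uniformly in $k\in\mathbb{Z}$ and $n\in\{0,1,\ldots,M^j-1\}$.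
   Context: Fourier transform: $\mathcal{F}f(\omega)=\int_{\mathbb{R}} f(t)e^{-i\omega t}\,dt$. The autocorrelation function of $X$ is $R(t-s)=\mathbb{E}[X(t)X(s)]$; the spectrum $\gamma$ is the Fourier transform of $R$ (assumed to exist). Filters: a filter $h_m$ has frequency response $H_m(\omega)=\frac{1}{\sqrt{M}}\sum_{\ell\in\mathbb{Z}}h_m[\ell]e^{-i\ell\omega}$. A family $(h_m)_{0\le m\le M-1}$ is paraunitary if for a.e. $\omega$ the $M\times M$ matrix $\big(H_m(\omega+2\pi q/M)\big)_{0\le m,q\le M-1}$ is unitary; in particular $|H_m|\le 1$ a.e. The Shannon filters are given by $H^{S}_m(\omega)=\sum_{\ell\in\mathbb{Z}}\mathbf{1}_{\Delta_m}(\omega-2\pi\ell)$ with $\Delta_m=\left[-\frac{(m+1)\pi}{M},-\frac{m\pi}{M}\right]\cup\left[\frac{m\pi}{M},\frac{(m+1)\pi}{M}\right]$. Wavelet packet functions: for a family of filters with frequency responses $H_m$ (either $H_m=H^{[r]}_m$ or $H_m=H^{S}_m$) and $n=\sum_{\ell=1}^{j}m_\ell M^{j-\ell}\in\{0,\ldots,M^j-1\}$ with $m_\ell\in\{0,\ldots,M-1\}$, the function $W_{j,n}\in L^2(\mathbb{R})$ (denoted $W^{[r]}_{j,n}$, resp. $W^{S}_{j,n}$) has Fourier transform $$\mathcal{F}W_{j,n}(\omega)=M^{j/2}\Big[\prod_{\ell=1}^{j}H_{m_\ell}(M^{\ell-1}\omega)\Big]\mathbf{1}_{[-\pi,\pi]}(\omega),$$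 and $W_{j,n,k}(t)=W_{j,n}(t-M^jk)$ for $k\in\mathbb{Z}$. The wavelet packet coefficients of $X$ at node $(j,n)$ are $c_{j,n}[k]=\int_{\mathbb{R}}X(t)W_{j,n,k}(t)\,dt$, $k\in\mathbb{Z}$ (the integrals are assumed to exist in the second-order sense). The process $(c_{j,n}[k])_k$ is wide-sense stationary and its autocorrelation function $R_{j,n}[k-\ell]=\mathbb{E}[c_{j,n}[k]c_{j,n}[\ell]]$ is given by $$R_{j,n}[k]=\frac{1}{2\pi}\int_{\mathbb{R}}\gamma(\omega)\,|\mathcal{F}W_{j,n}(\omega)|^2e^{iM^{j}k\omega}\,d\omega .$$ *)

theory Defs
  imports "HOL-Probability.Probability" "Jordan_Normal_Form.Schur_Decomposition"
begin

section \<open>Square integrability and the Fourier transform on \<open>L\<^sup>2\<close>\<close>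

definition square_integrable :: "'a measure \<Rightarrow> ('a \<Rightarrow> 'b::{real_normed_vector,second_countable_topology}) \<Rightarrow> bool"
  where "square_integrable M f \<longleftrightarrow>
    f \<in> borel_measurable M \<and> integrable M (\<lambda>x. (norm (f x))\<^sup>2)"

text \<open>
  \<open>has_fourier_transform f g\<close>: \<open>g\<close> is the transform \<open>\<integral> f(t) exp(-i\<omega>t) dt\<close> of \<open>f\<close>, where the
  integral over the line is the limit in \<open>L\<^sup>2\<close> of the integrals over \<open>[-T, T]\<close> (Plancherel).
  This reading is needed because neither the Shannon wavelet packets nor the autocorrelation
  function of band-limited white noise is absolutely integrable.  The \<open>L\<^sup>2\<close> distance is a
  nonnegative integral, so that a divergent integral cannot be mistaken for \<open>0\<close>.
\<close>
definition has_fourier_transform :: "(real \<Rightarrow> complex) \<Rightarrow> (real \<Rightarrow> complex) \<Rightarrow> bool"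
  where "has_fourier_transform f g \<longleftrightarrow>
    square_integrable lborel f \<and> square_integrable lborel g \<and>
    ((\<lambda>T. \<integral>\<^sup>+\<omega>. ennreal ((norm (g \<omega> - (LINT t:{-T..T}|lborel. f t * exp (- (\<i> * of_real (\<omega> * t))))))\<^sup>2) \<partial>lborel)
       \<longlongrightarrow> 0) at_top"

section \<open>Second-order processes\<close>

definition centred :: "'a measure \<Rightarrow> ('i \<Rightarrow> 'a \<Rightarrow> real) \<Rightarrow> bool"
  where "centred P Y \<longleftrightarrow> (\<forall>t. (\<integral>x. Y t x \<partial>P) = 0)"

definition second_order :: "'a measure \<Rightarrow> ('i \<Rightarrow> 'a \<Rightarrow> real) \<Rightarrow> bool"
  where "second_order P Y \<longleftrightarrow> (\<forall>t. square_integrable P (Y t))"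

definition wide_sense_stationary :: "'a measure \<Rightarrow> ('i::ab_group_add \<Rightarrow> 'a \<Rightarrow> real) \<Rightarrow> bool"
  where "wide_sense_stationary P Y \<longleftrightarrow> second_order P Y \<and>
    (\<forall>s t. (\<integral>x. Y s x \<partial>P) = (\<integral>x. Y t x \<partial>P)) \<and>
    (\<forall>s t u. (\<integral>x. Y (s + u) x * Y (t + u) x \<partial>P) = (\<integral>x. Y s x * Y t x \<partial>P))"

definition continuous_in_quadratic_mean :: "'a measure \<Rightarrow> (real \<Rightarrow> 'a \<Rightarrow> real) \<Rightarrow> bool"
  where "continuous_in_quadratic_mean P Y \<longleftrightarrow>
    (\<forall>t. ((\<lambda>s. \<integral>x. (Y s x - Y t x)\<^sup>2 \<partial>P) \<longlongrightarrow> 0) (at t))"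

text \<open>
  For a wide-sense stationary process \<open>Y\<close> this is the function \<open>R\<close> with
  \<open>E[Y(t) Y(s)] = R(t - s)\<close> for all \<open>t\<close> and \<open>s\<close>.
\<close>
definition autocorrelation :: "'a measure \<Rightarrow> ('i::ab_group_add \<Rightarrow> 'a \<Rightarrow> real) \<Rightarrow> 'i \<Rightarrow> real"
  where "autocorrelation P Y k = (\<integral>x. Y k x * Y 0 x \<partial>P)"

lemma autocorrelation_diff:
  assumes "wide_sense_stationary P Y"
  shows "(\<integral>x. Y t x * Y s x \<partial>P) = autocorrelation P Y (t - s)"
proof -
  have "(\<integral>x. Y ((t - s) + s) x * Y (0 + s) x \<partial>P) = (\<integral>x. Y (t - s) x * Y 0 x \<partial>P)"
    using assms unfolding wide_sense_stationary_def by blast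
  then show ?thesis by (simp add: autocorrelation_def)
qed

definition is_spectrum :: "'a measure \<Rightarrow> (real \<Rightarrow> 'a \<Rightarrow> real) \<Rightarrow> (real \<Rightarrow> complex) \<Rightarrow> bool"
  where "is_spectrum P X \<gamma> \<longleftrightarrow>
    has_fourier_transform (\<lambda>t. of_real (autocorrelation P X t)) \<gamma>"

definition essentially_bounded :: "(real \<Rightarrow> complex) \<Rightarrow> bool"
  where "essentially_bounded f \<longleftrightarrow>
    f \<in> borel_measurable lborel \<and> (\<exists>C. AE \<omega> in lborel. norm (f \<omega>) \<le> C)"

definition supported_within :: "real set \<Rightarrow> (real \<Rightarrow> complex) \<Rightarrow> bool"
  where "supported_within S f \<longleftrightarrow> (AE \<omega> in lborel. \<omega> \<notin> S \<longrightarrow> f \<omega> = 0)"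

text \<open>Riemann integral over \<open>[a, b]\<close>, with convergence of the Riemann sums in quadratic mean.\<close>
definition has_ms_integral ::
    "'a measure \<Rightarrow> (real \<Rightarrow> 'a \<Rightarrow> real) \<Rightarrow> real \<Rightarrow> real \<Rightarrow> ('a \<Rightarrow> real) \<Rightarrow> bool"
  where "has_ms_integral P Y a b J \<longleftrightarrow> square_integrable P J \<and>
    (\<forall>e>0. \<exists>d>0. \<forall>D. D tagged_division_of {a..b} \<and> (\<lambda>t. ball t d) fine D \<longrightarrow>
       (\<integral>x. ((\<Sum>(t, K)\<in>D. measure lborel K * Y t x) - J x)\<^sup>2 \<partial>P) < e)"

text \<open>Improper mean-square integral over the line; the two end points move independently.\<close>
definition has_ms_integral_line ::
    "'a measure \<Rightarrow> (real \<Rightarrow> 'a \<Rightarrow> real) \<Rightarrow> ('a \<Rightarrow> real) \<Rightarrow> bool"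
  where "has_ms_integral_line P Y I \<longleftrightarrow> square_integrable P I \<and>
    (\<exists>J. (\<forall>a b. a \<le> b \<longrightarrow> has_ms_integral P Y a b (J a b)) \<and>
      ((\<lambda>(a, b). \<integral>x. (J a b x - I x)\<^sup>2 \<partial>P) \<longlongrightarrow> 0) (at_bot \<times>\<^sub>F at_top))"

section \<open>Filters\<close>

text \<open>
  The series defining the frequency response converges in \<open>L\<^sup>2\<close> over a period.  The relation
  determines \<open>H\<close> up to a null set.
\<close>
definition has_frequency_response :: "nat \<Rightarrow> (int \<Rightarrow> real) \<Rightarrow> (real \<Rightarrow> complex) \<Rightarrow> bool"
  where "has_frequency_response M h H \<longleftrightarrow>
    H \<in> borel_measurable lborel \<and>
    (AE \<omega> in lborel. H (\<omega> + 2 * pi) = H \<omega>) \<and>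
    (\<lambda>N. \<integral>\<^sup>+\<omega>\<in>{-pi..pi}. ennreal ((norm (H \<omega> -
        1 / of_real (sqrt (real M)) *
          (\<Sum>l\<in>{- int N..int N}. of_real (h l) * exp (- (\<i> * of_real (of_int l * \<omega>))))))\<^sup>2) \<partial>lborel)
      \<longlonglongrightarrow> 0"

definition unitary_mat :: "nat \<Rightarrow> complex mat \<Rightarrow> bool"
  where "unitary_mat n U \<longleftrightarrow> U \<in> carrier_mat n n \<and>
    U * mat_adjoint U = 1\<^sub>m n \<and> mat_adjoint U * U = 1\<^sub>m n"

definition paraunitary :: "nat \<Rightarrow> (nat \<Rightarrow> real \<Rightarrow> complex) \<Rightarrow> bool"
  where "paraunitary M H \<longleftrightarrow>
    (AE \<omega> in lborel. unitary_mat M (mat M M (\<lambda>(m, q). H m (\<omega> + 2 * pi * real q / real M))))"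

definition shannon_band :: "nat \<Rightarrow> nat \<Rightarrow> real set"
  where "shannon_band M m =
    {- (real (m + 1) * pi / real M) .. - (real m * pi / real M)} \<union>
    {real m * pi / real M .. real (m + 1) * pi / real M}"

text \<open>For each \<open>\<omega>\<close> only finitely many terms of the sum are nonzero.\<close>
definition shannon_response :: "nat \<Rightarrow> nat \<Rightarrow> real \<Rightarrow> complex"
  where "shannon_response M m \<omega> =
    (\<Sum>\<^sub>\<infinity>l\<in>(UNIV::int set). indicator (shannon_band M m) (\<omega> - 2 * pi * of_int l))"

section \<open>Wavelet packets\<close>

text \<open>The digit \<open>m\<^sub>l\<close> in the base-\<open>M\<close> expansion of \<open>n\<close>, for \<open>1 \<le> l \<le> j\<close>.\<close>
definition packet_digit :: "nat \<Rightarrow> nat \<Rightarrow> nat \<Rightarrow> nat \<Rightarrow> nat"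
  where "packet_digit M j n l = (n div M ^ (j - l)) mod M"

lemma packet_digit_less: "M > 0 \<Longrightarrow> packet_digit M j n l < M"
  by (simp add: packet_digit_def)

lemma packet_digit_expansion:
  assumes "M > 0" and "n < M ^ j"
  shows "n = (\<Sum>l=1..j. packet_digit M j n l * M ^ (j - l))"
  using assms(2)
proof (induction j arbitrary: n)
  case 0
  then show ?case by simp
next
  case (Suc j)
  have lt: "n div M < M ^ j"
    using Suc.prems assms(1) by (simp add: less_mult_imp_div_less mult.commute)
  have step: "packet_digit M (Suc j) n l * M ^ (Suc j - l)
      = packet_digit M j (n div M) l * M ^ (j - l) * M" if "l \<in> {1..j}" for l
    using that by (simp add: packet_digit_def Suc_diff_le div_mult2_eq)
  have "(\<Sum>l=1..Suc j. packet_digit M (Suc j) n l * M ^ (Suc j - l))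
      = (\<Sum>l=1..j. packet_digit M (Suc j) n l * M ^ (Suc j - l)) + n mod M"
    by (simp add: packet_digit_def)
  also have "(\<Sum>l=1..j. packet_digit M (Suc j) n l * M ^ (Suc j - l))
      = (\<Sum>l=1..j. packet_digit M j (n div M) l * M ^ (j - l)) * M"
    unfolding sum_distrib_right by (intro sum.cong refl step)
  also have "\<dots> = n div M * M"
    using Suc.IH[OF lt] by simp
  finally show ?case by simp
qed

definition packet_response ::
    "nat \<Rightarrow> (nat \<Rightarrow> real \<Rightarrow> complex) \<Rightarrow> nat \<Rightarrow> nat \<Rightarrow> real \<Rightarrow> complex"
  where "packet_response M H j n \<omega> =
    of_real (real M powr (real j / 2)) *
    (\<Prod>l=1..j. H (packet_digit M j n l) (real (M ^ (l - 1)) * \<omega>)) *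
    indicator {-pi..pi} \<omega>"

text \<open>
  The conditions determine \<open>W\<close> uniquely: a Paley--Wiener function is identified with its
  continuous representative, on which the Riemann sums of the coefficients are evaluated.
\<close>
definition is_wavelet_packet ::
    "nat \<Rightarrow> (nat \<Rightarrow> real \<Rightarrow> complex) \<Rightarrow> nat \<Rightarrow> nat \<Rightarrow> (real \<Rightarrow> real) \<Rightarrow> bool"
  where "is_wavelet_packet M H j n W \<longleftrightarrow>
    continuous_on UNIV W \<and>
    has_fourier_transform (\<lambda>t. of_real (W t)) (packet_response M H j n)"

definition is_packet_coefficients ::
    "'a measure \<Rightarrow> (real \<Rightarrow> 'a \<Rightarrow> real) \<Rightarrow> nat \<Rightarrow> nat \<Rightarrow> (real \<Rightarrow> real) \<Rightarrow> (int \<Rightarrow> 'a \<Rightarrow> real) \<Rightarrow> bool"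
  where "is_packet_coefficients P X M j W c \<longleftrightarrow>
    (\<forall>k. has_ms_integral_line P (\<lambda>t x. X t x * W (t - real (M ^ j) * of_int k)) (c k))"

end

theory Submission
  imports Defs
begin

text \<open>
  Since \<open>R\<close> is continuous and bounded and \<open>\<gamma>\<close> is integrable, Gaussian regularisation inverts
  the \<open>L\<^sup>2\<close> Fourier transform: \<open>E[X(t) X(s)] = 1/(2\<pi>) \<integral> \<gamma>(\<omega>) exp(i\<omega>(t-s)) d\<omega>\<close>.  Hence
  \<open>X(t) \<mapsto> exp(-i\<omega>t)\<close> preserves inner products when the spectral side carries the weight
  \<open>\<gamma>/(2\<pi>)\<close> on \<open>[-\<pi>, \<pi>]\<close>.  Riemann sums carry this over to the coefficients, \<open>c[k]\<close> being
  matched with \<open>exp(-i\<omega>M\<^sup>jk)\<close> times the packet response, which gives the integral formula for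
  their autocorrelation.  The factor depending on \<open>k\<close> has modulus 1, so two
  autocorrelations differ by at most a constant times the \<open>L\<^sup>1\<close> distance on \<open>[-\<pi>, \<pi>]\<close> of
  the squared moduli of the responses, uniformly in \<open>k\<close>.  Paraunitarity bounds the responses,
  and dominated convergence finishes the proof.
\<close>

section \<open>Square-integrable functions\<close>

text \<open>Being built on the Bochner integral, this is 0 when the squared norm is not integrable,
  so it is a meaningful size only under \<open>square_integrable\<close>.\<close>

definition l2norm :: "'a measure \<Rightarrow> ('a \<Rightarrow> 'b::{real_normed_vector,second_countable_topology}) \<Rightarrow> real"
  where "l2norm N f = sqrt (\<integral>x. (norm (f x))\<^sup>2 \<partial>N)"

lemma square_integrable_integrable_mult:
  fixes f g :: "'a \<Rightarrow> 'b::{real_normed_field,banach,second_countable_topology}"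
  assumes f: "square_integrable N f" and g: "square_integrable N g"
  shows "integrable N (\<lambda>x. f x * g x)"
proof (rule Bochner_Integration.integrable_bound)
  show "integrable N (\<lambda>x. (norm (f x))\<^sup>2 + (norm (g x))\<^sup>2)"
    using f g by (auto simp: square_integrable_def)
  show "(\<lambda>x. f x * g x) \<in> borel_measurable N"
    using f g by (auto simp: square_integrable_def)
  have "norm (f x * g x) \<le> norm ((norm (f x))\<^sup>2 + (norm (g x))\<^sup>2)" for x
  proof -
    have "2 * (norm (f x) * norm (g x)) \<le> (norm (f x))\<^sup>2 + (norm (g x))\<^sup>2"
      using sum_squares_bound[of "norm (f x)" "norm (g x)"] by simp
    moreover have "0 \<le> norm (f x) * norm (g x)" by simp
    ultimately have "norm (f x) * norm (g x) \<le> (norm (f x))\<^sup>2 + (norm (g x))\<^sup>2" by linarith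
    then show ?thesis by (simp add: norm_mult)
  qed
  then show "AE x in N. norm (f x * g x) \<le> norm ((norm (f x))\<^sup>2 + (norm (g x))\<^sup>2)" by simp
qed

text \<open>The product is taken without conjugation, so that one statement serves real random
  variables and complex spectral functions. The inequality for nonnegative integrals is applied to
  the pointwise norms, and square integrability makes all these integrals finite.\<close>

lemma Cauchy_Schwarz_integral:
  fixes f g :: "'a \<Rightarrow> 'b::{real_normed_field,banach,second_countable_topology}"
  assumes f: "square_integrable N f" and g: "square_integrable N g"
  shows "norm (\<integral>x. f x * g x \<partial>N) \<le> l2norm N f * l2norm N g"
proof -
  have [measurable]: "f \<in> borel_measurable N" "g \<in> borel_measurable N"
    and sq: "integrable N (\<lambda>x. (norm (f x))\<^sup>2)" "integrable N (\<lambda>x. (norm (g x))\<^sup>2)"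
    using f g by (auto simp: square_integrable_def)
  let ?I = "\<integral>x. norm (f x) * norm (g x) \<partial>N"
  have int: "integrable N (\<lambda>x. norm (f x) * norm (g x))"
    using integrable_norm[OF square_integrable_integrable_mult[OF f g]] by (simp add: norm_mult)
  have "(\<integral>\<^sup>+x. ennreal (norm (f x)) * ennreal (norm (g x)) \<partial>N)\<^sup>2
      \<le> (\<integral>\<^sup>+x. (ennreal (norm (f x)))\<^sup>2 \<partial>N) * (\<integral>\<^sup>+x. (ennreal (norm (g x)))\<^sup>2 \<partial>N)"
    by (rule Cauchy_Schwarz_nn_integral) auto
  also have "(\<integral>\<^sup>+x. ennreal (norm (f x)) * ennreal (norm (g x)) \<partial>N) = ennreal ?I"
    using int by (simp add: nn_integral_eq_integral flip: ennreal_mult)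
  also have "(\<integral>\<^sup>+x. (ennreal (norm (f x)))\<^sup>2 \<partial>N) = ennreal (\<integral>x. (norm (f x))\<^sup>2 \<partial>N)"
    using sq by (simp add: nn_integral_eq_integral ennreal_power)
  also have "(\<integral>\<^sup>+x. (ennreal (norm (g x)))\<^sup>2 \<partial>N) = ennreal (\<integral>x. (norm (g x))\<^sup>2 \<partial>N)"
    using sq by (simp add: nn_integral_eq_integral ennreal_power)
  finally have "?I\<^sup>2 \<le> (\<integral>x. (norm (f x))\<^sup>2 \<partial>N) * (\<integral>x. (norm (g x))\<^sup>2 \<partial>N)"
    by (simp add: ennreal_power flip: ennreal_mult)
  then have "?I \<le> l2norm N f * l2norm N g"
    unfolding l2norm_def real_sqrt_mult[symmetric] by (rule real_le_rsqrt)
  moreover have "norm (\<integral>x. f x * g x \<partial>N) \<le> ?I"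
    using integral_norm_bound[of N "\<lambda>x. f x * g x"] by (simp add: norm_mult)
  ultimately show ?thesis by linarith
qed

lemma norm_add_square_le:
  fixes a b :: "'b::real_normed_vector"
  shows "(norm (a + b))\<^sup>2 \<le> 2 * (norm a)\<^sup>2 + 2 * (norm b)\<^sup>2"
proof -
  have "(norm (a + b))\<^sup>2 \<le> (norm a + norm b)\<^sup>2"
    by (intro power_mono norm_triangle_ineq) auto
  also have "\<dots> \<le> 2 * (norm a)\<^sup>2 + 2 * (norm b)\<^sup>2"
    using sum_squares_bound[of "norm a" "norm b"] by (simp add: power2_sum)
  finally show ?thesis .
qed

lemma square_integrable_add:
  fixes f g :: "'a \<Rightarrow> 'b::{real_normed_vector,second_countable_topology}"
  assumes f: "square_integrable N f" and g: "square_integrable N g"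
  shows "square_integrable N (\<lambda>x. f x + g x)"
proof -
  have [measurable]: "f \<in> borel_measurable N" "g \<in> borel_measurable N"
    and sq: "integrable N (\<lambda>x. (norm (f x))\<^sup>2)" "integrable N (\<lambda>x. (norm (g x))\<^sup>2)"
    using f g by (auto simp: square_integrable_def)
  have "integrable N (\<lambda>x. (norm (f x + g x))\<^sup>2)"
    by (rule Bochner_Integration.integrable_bound
          [where f = "\<lambda>x. 2 * (norm (f x))\<^sup>2 + 2 * (norm (g x))\<^sup>2"])
       (use sq norm_add_square_le in auto)
  then show ?thesis by (simp add: square_integrable_def)
qed

lemma square_integrable_mult_bounded:
  fixes f g :: "'a \<Rightarrow> 'b::{real_normed_field,second_countable_topology}"
  assumes f: "square_integrable N f" and [measurable]: "g \<in> borel_measurable N"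
    and bd: "AE x in N. norm (g x) \<le> C"
  shows "square_integrable N (\<lambda>x. g x * f x)"
proof -
  have [measurable]: "f \<in> borel_measurable N"
    and sq: "integrable N (\<lambda>x. (norm (f x))\<^sup>2)"
    using f by (auto simp: square_integrable_def)
  have "integrable N (\<lambda>x. (norm (g x * f x))\<^sup>2)"
  proof (rule Bochner_Integration.integrable_bound[where f = "\<lambda>x. C\<^sup>2 * (norm (f x))\<^sup>2"])
    show "AE x in N. norm ((norm (g x * f x))\<^sup>2) \<le> norm (C\<^sup>2 * (norm (f x))\<^sup>2)"
      using bd by eventually_elim
        (auto simp: norm_mult power_mult_distrib intro!: mult_right_mono power_mono)
  qed (use sq in auto)
  then show ?thesis by (simp add: square_integrable_def)
qed

lemma square_integrable_cmult:
  fixes f :: "'a \<Rightarrow> 'b::{real_normed_field,second_countable_topology}"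
  assumes "square_integrable N f"
  shows "square_integrable N (\<lambda>x. c * f x)"
  by (rule square_integrable_mult_bounded[OF assms, of "\<lambda>_. c" "norm c"]) auto

lemma square_integrable_diff:
  fixes f g :: "'a \<Rightarrow> 'b::{real_normed_field,second_countable_topology}"
  assumes "square_integrable N f" "square_integrable N g"
  shows "square_integrable N (\<lambda>x. f x - g x)"
  using square_integrable_add[OF assms(1) square_integrable_cmult[OF assms(2), of "-1"]] by simp

lemma square_integrable_sum:
  fixes f :: "'i \<Rightarrow> 'a \<Rightarrow> 'b::{real_normed_field,second_countable_topology}"
  assumes "\<And>i. i \<in> I \<Longrightarrow> square_integrable N (f i)"
  shows "square_integrable N (\<lambda>x. \<Sum>i\<in>I. f i x)"
  using assms
proof (induction I rule: infinite_finite_induct)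
  case (insert i I)
  then show ?case using square_integrable_add[of N "f i" "\<lambda>x. \<Sum>i\<in>I. f i x"] by simp
qed (simp_all add: square_integrable_def)

text \<open>Continuity of the bilinear pairing in mean square. The approximants have to be square
  integrable only eventually, because truncated Fourier transforms are shown below to be so only for
  large truncation lengths.\<close>

lemma tendsto_integral_mult:
  fixes f g :: "'a \<Rightarrow> 'b::{real_normed_field,banach,second_countable_topology}"
  assumes f: "square_integrable N f" and g: "square_integrable N g"
    and fi: "eventually (\<lambda>i. square_integrable N (f' i)) F"
    and gi: "eventually (\<lambda>i. square_integrable N (g' i)) F"
    and flim: "((\<lambda>i. \<integral>x. (norm (f' i x - f x))\<^sup>2 \<partial>N) \<longlongrightarrow> 0) F"
    and glim: "((\<lambda>i. \<integral>x. (norm (g' i x - g x))\<^sup>2 \<partial>N) \<longlongrightarrow> 0) F"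
  shows "((\<lambda>i. \<integral>x. f' i x * g' i x \<partial>N) \<longlongrightarrow> (\<integral>x. f x * g x \<partial>N)) F"
proof -
  let ?df = "\<lambda>i x. f' i x - f x" and ?dg = "\<lambda>i x. g' i x - g x"
  have flim: "((\<lambda>i. l2norm N (?df i)) \<longlongrightarrow> 0) F"
    using tendsto_real_sqrt[OF flim] by (simp add: l2norm_def)
  have glim: "((\<lambda>i. l2norm N (?dg i)) \<longlongrightarrow> 0) F"
    using tendsto_real_sqrt[OF glim] by (simp add: l2norm_def)
  let ?B = "\<lambda>i. l2norm N (?df i) * l2norm N (?dg i) + l2norm N (?df i) * l2norm N g
    + l2norm N f * l2norm N (?dg i)"
  have "((\<lambda>i. (\<integral>x. f' i x * g' i x \<partial>N) - (\<integral>x. f x * g x \<partial>N)) \<longlongrightarrow> 0) F"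
  proof (rule Lim_null_comparison)
    show "eventually (\<lambda>i. norm ((\<integral>x. f' i x * g' i x \<partial>N) - (\<integral>x. f x * g x \<partial>N)) \<le> ?B i) F"
      using fi gi
    proof eventually_elim
      case (elim i)
      have df: "square_integrable N (?df i)" and dg: "square_integrable N (?dg i)"
        using elim f g by (auto intro: square_integrable_diff)
      note [simp] = square_integrable_integrable_mult
      have "(\<integral>x. f' i x * g' i x \<partial>N) - (\<integral>x. f x * g x \<partial>N)
          = (\<integral>x. f' i x * g' i x - f x * g x \<partial>N)"
        using elim f g by simp
      also have "\<dots> = (\<integral>x. (?df i x * ?dg i x + ?df i x * g x) + f x * ?dg i x \<partial>N)"
        by (simp add: algebra_simps)
      also have "\<dots> = (\<integral>x. ?df i x * ?dg i x \<partial>N) + (\<integral>x. ?df i x * g x \<partial>N) + (\<integral>x. f x * ?dg i x \<partial>N)"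
        using df dg f g by (simp only: Bochner_Integration.integral_add
            Bochner_Integration.integrable_add square_integrable_integrable_mult)
      finally have eq: "(\<integral>x. f' i x * g' i x \<partial>N) - (\<integral>x. f x * g x \<partial>N) = \<dots>" .
      show ?case unfolding eq
        by (intro norm_triangle_mono Cauchy_Schwarz_integral df dg f g)
    qed
    show "(?B \<longlongrightarrow> 0) F"
      by (rule tendsto_eq_intros flim glim | simp)+
  qed
  then show ?thesis by (rule LIM_zero_cancel)
qed

section \<open>Fourier inversion\<close>

lemma integrable_gaussian:
  fixes \<epsilon> :: real
  assumes "\<epsilon> > 0"
  shows "integrable lborel (\<lambda>\<omega>. exp (- (\<epsilon> * \<omega>)\<^sup>2 / 2))"
proof -
  have "integrable lborel (\<lambda>\<omega>. sqrt (2 * pi) * std_normal_density (0 + \<epsilon> * \<omega>))"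
    using assms by (intro integrable_mult_right lborel_integrable_real_affine) auto
  then show ?thesis by (simp add: std_normal_density_def)
qed

text \<open>This is the characteristic function of the standard normal law at
  \<open>v / \<epsilon>\<close>, rescaled by x = \<epsilon> * \<omega>. The right side is kept as 2
  pi times the centred normal density of standard deviation \<epsilon> at \<open>v\<close>, which
  later acts as an approximate identity.\<close>

lemma fourier_gaussian:
  fixes \<epsilon> v :: real
  assumes "\<epsilon> > 0"
  shows "(\<integral>\<omega>. exp (\<i> * of_real (\<omega> * v)) * of_real (exp (- (\<epsilon> * \<omega>)\<^sup>2 / 2)) \<partial>lborel)
    = complex_of_real (2 * pi / \<epsilon> * std_normal_density (v / \<epsilon>))"
proof -
  let ?f = "\<lambda>x. exp (\<i> * of_real (x * (v / \<epsilon>))) * complex_of_real (exp (- x\<^sup>2 / 2))"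
  have "complex_of_real (exp (- (v / \<epsilon>)\<^sup>2 / 2)) = char std_normal_distribution (v / \<epsilon>)"
    by (simp add: char_std_normal_distribution)
  also have "\<dots> = (\<integral>x. std_normal_density x *\<^sub>R exp (\<i> * of_real (v / \<epsilon> * x)) \<partial>lborel)"
    unfolding char_def by (rule integral_density) auto
  also have "\<dots> = (\<integral>x. complex_of_real (1 / sqrt (2 * pi)) * ?f x \<partial>lborel)"
    by (intro Bochner_Integration.integral_cong)
       (simp_all add: std_normal_density_def scaleR_conv_of_real mult_ac)
  also have "\<dots> = complex_of_real (1 / sqrt (2 * pi)) * (\<integral>x. ?f x \<partial>lborel)"
    by (rule integral_mult_right_zero)
  also have "(\<integral>x. ?f x \<partial>lborel) = \<bar>\<epsilon>\<bar> *\<^sub>R (\<integral>\<omega>. ?f (0 + \<epsilon> * \<omega>) \<partial>lborel)"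
    using assms by (intro lborel_integral_real_affine) auto
  also have "(\<integral>\<omega>. ?f (0 + \<epsilon> * \<omega>) \<partial>lborel)
      = (\<integral>\<omega>. exp (\<i> * of_real (\<omega> * v)) * of_real (exp (- (\<epsilon> * \<omega>)\<^sup>2 / 2)) \<partial>lborel)"
    using assms by (intro Bochner_Integration.integral_cong) (simp_all add: field_simps)
  finally have *: "complex_of_real (exp (- (v / \<epsilon>)\<^sup>2 / 2)) =
      complex_of_real (1 / sqrt (2 * pi)) * (\<bar>\<epsilon>\<bar> *\<^sub>R (\<integral>\<omega>. exp (\<i> * of_real (\<omega> * v)) * of_real (exp (- (\<epsilon> * \<omega>)\<^sup>2 / 2)) \<partial>lborel))"
    (is "_ = _ * (_ *\<^sub>R ?I)") .
  have s: "complex_of_real (sqrt (2 * pi)) * complex_of_real (sqrt (2 * pi)) = complex_of_real (2 * pi)"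
    by (simp flip: of_real_mult)
  have "?I = complex_of_real (sqrt (2 * pi) / \<epsilon>) * complex_of_real (exp (- (v / \<epsilon>)\<^sup>2 / 2))"
    unfolding * using assms by (simp add: scaleR_conv_of_real)
  also have "\<dots> = complex_of_real (2 * pi / \<epsilon> * std_normal_density (v / \<epsilon>))"
    unfolding of_real_mult[symmetric] of_real_eq_iff std_normal_density_def
    using assms by (simp add: field_simps)
  finally show ?thesis .
qed

text \<open>Fubini's theorem applies because the truncation gives integrability in \<open>t\<close>
  and the Gaussian gives it in \<omega>. The inner frequency integral is then
  \<open>fourier_gaussian\<close> with \<open>v = u - t\<close>.\<close>

lemma truncated_fourier_gaussian:
  fixes f :: "real \<Rightarrow> complex" and \<epsilon> u T :: real
  assumes \<epsilon>: "\<epsilon> > 0" and f: "continuous_on UNIV f"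
  shows "(\<integral>\<omega>. (LINT t:{-T..T}|lborel. f t * exp (- (\<i> * of_real (\<omega> * t)))) *
      (exp (\<i> * of_real (\<omega> * u)) * of_real (exp (- (\<epsilon> * \<omega>)\<^sup>2 / 2))) \<partial>lborel)
    = (LINT t:{-T..T}|lborel. f t * of_real (2 * pi / \<epsilon> * std_normal_density ((u - t) / \<epsilon>)))"
proof -
  have [measurable]: "f \<in> borel_measurable borel"
    using f by (rule borel_measurable_continuous_onI)
  let ?\<phi> = "\<lambda>\<omega>. exp (\<i> * of_real (\<omega> * u)) * complex_of_real (exp (- (\<epsilon> * \<omega>)\<^sup>2 / 2))"
  let ?K = "\<lambda>\<omega> t. (indicator {-T..T} t *\<^sub>R (f t * exp (- (\<i> * of_real (\<omega> * t))))) * ?\<phi> \<omega>"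
  have ff: "integrable lborel (\<lambda>t. indicator {-T..T} t *\<^sub>R f t)"
    using borel_integrable_atLeastAtMost'[OF continuous_on_subset[OF f], of "-T" T]
    by (simp add: set_integrable_def)
  have nK: "norm (?K \<omega> t) = norm (indicator {-T..T} t *\<^sub>R f t) * exp (- (\<epsilon> * \<omega>)\<^sup>2 / 2)" for \<omega> t
    by (simp add: norm_mult)
  have "integrable (lborel \<Otimes>\<^sub>M lborel) (\<lambda>(\<omega>, t). ?K \<omega> t)"
  proof (rule lborel_pair.Fubini_integrable)
    show "(\<lambda>(\<omega>, t). ?K \<omega> t) \<in> borel_measurable (lborel \<Otimes>\<^sub>M lborel)" by measurable
    show "integrable lborel (\<lambda>\<omega>. \<integral>t. norm (case (\<omega>, t) of (\<omega>, t) \<Rightarrow> ?K \<omega> t) \<partial>lborel)"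
      unfolding case_prod_conv nK using integrable_gaussian[OF \<epsilon>] by simp
    have "integrable lborel (\<lambda>t. ?K \<omega> t)" for \<omega>
    proof (rule Bochner_Integration.integrable_bound)
      show "integrable lborel (\<lambda>t. norm (indicator {-T..T} t *\<^sub>R f t) * exp (- (\<epsilon> * \<omega>)\<^sup>2 / 2))"
        using integrable_norm[OF ff] by (rule integrable_mult_left)
      show "AE t in lborel. norm (?K \<omega> t)
          \<le> norm (norm (indicator {-T..T} t *\<^sub>R f t) * exp (- (\<epsilon> * \<omega>)\<^sup>2 / 2))"
        unfolding nK by simp
    qed simp
    then show "AE \<omega> in lborel. integrable lborel (\<lambda>t. case (\<omega>, t) of (\<omega>, t) \<Rightarrow> ?K \<omega> t)" by simp
  qed
  then have "(\<integral>\<omega>. (\<integral>t. ?K \<omega> t \<partial>lborel) \<partial>lborel) = (\<integral>t. (\<integral>\<omega>. ?K \<omega> t \<partial>lborel) \<partial>lborel)"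
    using lborel_pair.Fubini_integral[of ?K] by simp
  moreover have "(\<integral>\<omega>. ?K \<omega> t \<partial>lborel) = indicator {-T..T} t *\<^sub>R
      (f t * of_real (2 * pi / \<epsilon> * std_normal_density ((u - t) / \<epsilon>)))" for t
  proof -
    have "(\<integral>\<omega>. ?K \<omega> t \<partial>lborel) = (\<integral>\<omega>. (indicator {-T..T} t *\<^sub>R f t) *
        (exp (\<i> * of_real (\<omega> * (u - t))) * of_real (exp (- (\<epsilon> * \<omega>)\<^sup>2 / 2))) \<partial>lborel)"
      by (intro Bochner_Integration.integral_cong)
         (simp_all add: ring_distribs exp_diff exp_minus field_simps)
    also have "\<dots> = (indicator {-T..T} t *\<^sub>R f t) *
        of_real (2 * pi / \<epsilon> * std_normal_density ((u - t) / \<epsilon>))"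
      unfolding integral_mult_right_zero fourier_gaussian[OF \<epsilon>] ..
    finally show ?thesis by (simp only: mult_scaleR_left)
  qed
  ultimately show ?thesis
    by (simp only: set_lebesgue_integral_def integral_mult_left_zero)
qed

text \<open>The transform is only an L2 limit, so it is tested against a Gaussian-damped
  exponential, which turns the truncated transforms into normal averages of \<open>f\<close> around
  \<open>u\<close>. When the damping is removed, boundedness and continuity of \<open>f\<close> make
  the averages tend to \<open>f u\<close>, and integrability of \<open>g\<close> handles the
  frequency side. The identity therefore holds at every \<open>u\<close>, not just almost
  everywhere.\<close>

lemma fourier_inversion:
  fixes f g :: "real \<Rightarrow> complex"
  assumes ft: "has_fourier_transform f g"
    and f: "continuous_on UNIV f" and bd: "\<And>t. norm (f t) \<le> B"
    and g: "integrable lborel g"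
  shows "f u = 1 / (2 * pi) * (\<integral>\<omega>. g \<omega> * exp (\<i> * of_real (\<omega> * u)) \<partial>lborel)"
proof -
  have fm [measurable]: "f \<in> borel_measurable borel"
    using f by (rule borel_measurable_continuous_onI)
  have [measurable]: "g \<in> borel_measurable borel" using g by auto
  have sg: "square_integrable lborel g" using ft by (simp add: has_fourier_transform_def)
  define G where "G T \<omega> = (LINT t:{-T..T}|lborel. f t * exp (- (\<i> * of_real (\<omega> * t))))" for T \<omega>
  have [measurable]: "G T \<in> borel_measurable borel" for T
    unfolding G_def[abs_def] set_lebesgue_integral_def by measurable
  define \<phi> where "\<phi> \<epsilon> \<omega> = exp (\<i> * of_real (\<omega> * u)) * complex_of_real (exp (- (\<epsilon> * \<omega>)\<^sup>2 / 2))" for \<epsilon> \<omega>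
  have [measurable]: "\<phi> \<epsilon> \<in> borel_measurable borel" for \<epsilon>
    unfolding \<phi>_def[abs_def] by measurable
  have nlim: "((\<lambda>T. \<integral>\<^sup>+\<omega>. ennreal ((norm (g \<omega> - G T \<omega>))\<^sup>2) \<partial>lborel) \<longlongrightarrow> 0) at_top"
    using ft by (simp add: has_fourier_transform_def G_def)
  \<comment> \<open>Any finite bound would do: it makes the difference from \<open>g\<close> square
    integrable, hence also \<open>G T\<close>.\<close>
  have "eventually (\<lambda>T. (\<integral>\<^sup>+\<omega>. ennreal ((norm (g \<omega> - G T \<omega>))\<^sup>2) \<partial>lborel) < 1) at_top"
    using nlim by (rule order_tendstoD) simp
  then have sG: "eventually (\<lambda>T. square_integrable lborel (G T)) at_top"
  proof eventually_elim
    case (elim T)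
    have "square_integrable lborel (\<lambda>\<omega>. g \<omega> - G T \<omega>)"
      using elim by (auto simp: square_integrable_def integrable_iff_bounded intro: order_less_trans)
    from square_integrable_diff[OF sg this] show ?case by simp
  qed
  have lim: "((\<lambda>T. \<integral>\<omega>. (norm (G T \<omega> - g \<omega>))\<^sup>2 \<partial>lborel) \<longlongrightarrow> 0) at_top"
  proof -
    have "((\<lambda>T. enn2real (\<integral>\<^sup>+\<omega>. ennreal ((norm (g \<omega> - G T \<omega>))\<^sup>2) \<partial>lborel)) \<longlongrightarrow> 0) at_top"
      by (rule tendsto_enn2real) (use nlim in auto)
    then show ?thesis
      by (subst integral_eq_nn_integral) (auto simp: norm_minus_commute)
  qed
  \<comment> \<open>Both sides arise as limits of the same integrals over [-i, i] with natural
    \<open>i\<close>: the left one by mean-square convergence of \<open>G T\<close>, the right one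
    by dominated convergence.\<close>
  have regularised: "(\<integral>\<omega>. g \<omega> * \<phi> \<epsilon> \<omega> \<partial>lborel)
      = 2 * pi * (\<integral>x. f (u - \<epsilon> * x) * of_real (std_normal_density x) \<partial>lborel)" if \<epsilon>: "\<epsilon> > 0" for \<epsilon>
  proof -
    let ?c = "\<lambda>t. 2 * pi / \<epsilon> * std_normal_density ((u - t) / \<epsilon>)"
    have c: "integrable lborel ?c"
    proof -
      have "integrable lborel (\<lambda>t. 2 * pi / \<epsilon> * std_normal_density (u / \<epsilon> + (- 1 / \<epsilon>) * t))"
        using \<epsilon> by (intro integrable_mult_right lborel_integrable_real_affine) auto
      then show ?thesis by (simp add: diff_divide_distrib)
    qed
    have c0: "?c t \<ge> 0" for t using \<epsilon> by simp
    have s\<phi>: "square_integrable lborel (\<phi> \<epsilon>)"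
    proof -
      \<comment> \<open>The square of the Gaussian factor is again Gaussian, with \<epsilon>
        replaced by \<open>sqrt 2 * \<epsilon>\<close>.\<close>
      have "(norm (\<phi> \<epsilon> \<omega>))\<^sup>2 = exp (- (sqrt 2 * \<epsilon> * \<omega>)\<^sup>2 / 2)" for \<omega>
        by (simp add: \<phi>_def norm_mult power_mult_distrib flip: exp_double)
      then show ?thesis
        using integrable_gaussian[of "sqrt 2 * \<epsilon>"] \<epsilon> by (simp add: square_integrable_def)
    qed
    have "((\<lambda>T. \<integral>\<omega>. G T \<omega> * \<phi> \<epsilon> \<omega> \<partial>lborel) \<longlongrightarrow> (\<integral>\<omega>. g \<omega> * \<phi> \<epsilon> \<omega> \<partial>lborel)) at_top"
      by (rule tendsto_integral_mult[OF sg s\<phi> sG _ lim]) (use s\<phi> in auto)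
    then have L1: "(\<lambda>i. LINT t:{-real i..real i}|lborel. f t * of_real (?c t))
        \<longlonglongrightarrow> (\<integral>\<omega>. g \<omega> * \<phi> \<epsilon> \<omega> \<partial>lborel)"
      unfolding G_def \<phi>_def truncated_fourier_gaussian[OF \<epsilon> f]
      by (rule filterlim_compose) (rule filterlim_real_sequentially)
    have L2: "(\<lambda>i. LINT t:{-real i..real i}|lborel. f t * of_real (?c t))
        \<longlonglongrightarrow> (\<integral>t. f t * of_real (?c t) \<partial>lborel)"
      unfolding set_lebesgue_integral_def
    proof (rule integral_dominated_convergence)
      show "integrable lborel (\<lambda>t. B * ?c t)" using c by (rule integrable_mult_right)
      show "AE t in lborel. (\<lambda>i. indicator {-real i..real i} t *\<^sub>R (f t * of_real (?c t)))
          \<longlonglongrightarrow> f t * of_real (?c t)"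
      proof (rule AE_I2)
        fix t
        have "eventually (\<lambda>i. real i \<ge> \<bar>t\<bar>) sequentially"
          using filterlim_real_sequentially by (simp add: filterlim_at_top)
        then have "eventually (\<lambda>i. indicator {-real i..real i} t *\<^sub>R (f t * of_real (?c t))
          = f t * of_real (?c t)) sequentially"
          by eventually_elim (auto simp: indicator_def)
        then show "(\<lambda>i. indicator {-real i..real i} t *\<^sub>R (f t * of_real (?c t)))
          \<longlonglongrightarrow> f t * of_real (?c t)" by (rule tendsto_eventually)
      qed
      fix i
      have "norm (indicator {-real i..real i} t *\<^sub>R (f t * of_real (?c t))) \<le> B * ?c t" for t
      proof -
        have "norm (f t * complex_of_real (?c t)) \<le> B * ?c t"
          unfolding norm_mult norm_of_real abs_of_nonneg[OF c0]
          by (intro mult_right_mono bd c0)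
        moreover have "0 \<le> B * ?c t"
          by (intro mult_nonneg_nonneg[OF _ c0] order_trans[OF norm_ge_zero bd])
        ultimately show ?thesis by (auto simp: indicator_def)
      qed
      then show "AE t in lborel. norm (indicator {-real i..real i} t *\<^sub>R (f t * of_real (?c t))) \<le> B * ?c t"
        by simp
    qed measurable
    \<comment> \<open>Substituting t = u - \<epsilon> * x moves \<epsilon> from the density into the
      argument of \<open>f\<close>, which leaves a fixed integrable weight for the limit of small
      \<epsilon>.\<close>
    have "(\<integral>t. f t * of_real (?c t) \<partial>lborel)
        = \<bar>- \<epsilon>\<bar> *\<^sub>R (\<integral>x. f (u + (- \<epsilon>) * x) * of_real (?c (u + (- \<epsilon>) * x)) \<partial>lborel)"
      using \<epsilon> by (intro lborel_integral_real_affine) auto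
    also have "\<dots> = \<epsilon> *\<^sub>R (\<integral>x. of_real (2 * pi / \<epsilon>) * (f (u - \<epsilon> * x) * of_real (std_normal_density x)) \<partial>lborel)"
      using \<epsilon> by (simp add: mult_ac)
    also have "\<dots> = 2 * pi * (\<integral>x. f (u - \<epsilon> * x) * of_real (std_normal_density x) \<partial>lborel)"
      unfolding integral_mult_right_zero using \<epsilon> by (simp add: scaleR_conv_of_real)
    finally show ?thesis using LIMSEQ_unique[OF L1 L2] by simp
  qed
  define e where "e i = 1 / real (Suc i)" for i
  have e0: "e \<longlonglongrightarrow> 0" unfolding e_def[abs_def] using LIMSEQ_inverse_real_of_nat by (simp add: inverse_eq_divide)
  have epos: "e i > 0" for i by (simp add: e_def)
  have A: "(\<lambda>i. \<integral>\<omega>. g \<omega> * \<phi> (e i) \<omega> \<partial>lborel) \<longlonglongrightarrow> (\<integral>\<omega>. g \<omega> * exp (\<i> * of_real (\<omega> * u)) \<partial>lborel)"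
  proof (rule integral_dominated_convergence[where w = "\<lambda>\<omega>. norm (g \<omega>)"])
    have "(\<lambda>i. g \<omega> * \<phi> (e i) \<omega>) \<longlonglongrightarrow>
        g \<omega> * (exp (\<i> * of_real (\<omega> * u)) * of_real (exp (- (0 * \<omega>)\<^sup>2 / 2)))" for \<omega>
      unfolding \<phi>_def by (intro tendsto_intros e0) simp
    then show "AE \<omega> in lborel. (\<lambda>i. g \<omega> * \<phi> (e i) \<omega>) \<longlonglongrightarrow> g \<omega> * exp (\<i> * of_real (\<omega> * u))"
      by simp
    show "AE \<omega> in lborel. norm (g \<omega> * \<phi> (e i) \<omega>) \<le> norm (g \<omega>)" for i
      by (auto simp: \<phi>_def norm_mult mult_left_le)
  qed (use g in auto)
  have B: "(\<lambda>i. \<integral>x. f (u - e i * x) * of_real (std_normal_density x) \<partial>lborel)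
      \<longlonglongrightarrow> (\<integral>x. f u * of_real (std_normal_density x) \<partial>lborel)"
  proof (rule integral_dominated_convergence[where w = "\<lambda>x. B * std_normal_density x"])
    have "(\<lambda>i. f (u - e i * x)) \<longlonglongrightarrow> f u" for x
    proof -
      have "(\<lambda>i. u - e i * x) \<longlonglongrightarrow> u - 0 * x" by (intro tendsto_intros e0)
      then have "(\<lambda>i. u - e i * x) \<longlonglongrightarrow> u" by simp
      moreover have "isCont f u" using f by (simp add: continuous_on_eq_continuous_at)
      ultimately show ?thesis by (rule isCont_tendsto_compose[rotated])
    qed
    then show "AE x in lborel. (\<lambda>i. f (u - e i * x) * of_real (std_normal_density x))
        \<longlonglongrightarrow> f u * of_real (std_normal_density x)"
      by (intro AE_I2 tendsto_mult tendsto_const)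
    show "AE x in lborel. norm (f (u - e i * x) * of_real (std_normal_density x))
        \<le> B * std_normal_density x" for i
      by (auto simp: norm_mult intro!: mult_right_mono bd)
  qed auto
  have "(\<integral>x. f u * of_real (std_normal_density x) \<partial>lborel) = f u"
    by simp
  with B have "(\<lambda>i. complex_of_real (2 * pi) * (\<integral>x. f (u - e i * x) * of_real (std_normal_density x) \<partial>lborel))
      \<longlonglongrightarrow> complex_of_real (2 * pi) * f u"
    by (intro tendsto_mult tendsto_const) simp
  with A have "(\<integral>\<omega>. g \<omega> * exp (\<i> * of_real (\<omega> * u)) \<partial>lborel) = complex_of_real (2 * pi) * f u"
    unfolding regularised[OF epos] by (auto intro: LIMSEQ_unique)
  then show ?thesis by simp
qed

section \<open>Spectral representation of random variables\<close>

text \<open>The total mass is finite, so constants and complex exponentials are square integrable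
  here, although they are not over the line.\<close>

abbreviation band :: "real measure"
  where "band \<equiv> restrict_space lborel {-pi..pi}"

lemma finite_measure_band: "finite_measure band"
  by (rule finite_measureI) (simp add: emeasure_restrict_space)

lemma measure_band: "measure band {-pi..pi} = 2 * pi"
  by (simp add: measure_restrict_space)

lemma integrable_band_bounded:
  fixes f :: "real \<Rightarrow> 'b::{banach,second_countable_topology}"
  assumes "f \<in> borel_measurable band" "\<And>\<omega>. norm (f \<omega>) \<le> C"
  shows "integrable band f"
  by (rule finite_measure.integrable_const_bound[OF finite_measure_band]) (use assms in auto)

lemma square_integrable_band_bounded:
  fixes f :: "real \<Rightarrow> complex"
  assumes "f \<in> borel_measurable borel" "\<And>\<omega>. norm (f \<omega>) \<le> C"
  shows "square_integrable band f"
  unfolding square_integrable_def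
proof
  show f: "f \<in> borel_measurable band"
    using assms(1) by (intro measurable_restrict_space1) simp
  have "norm ((norm (f \<omega>))\<^sup>2) \<le> C\<^sup>2" for \<omega>
    using assms(2)[of \<omega>] by (simp add: power_mono)
  then show "integrable band (\<lambda>\<omega>. (norm (f \<omega>))\<^sup>2)"
    using f by (intro integrable_band_bounded) auto
qed

lemma square_integrable_band:
  fixes f :: "real \<Rightarrow> complex"
  assumes "square_integrable lborel f"
  shows "square_integrable band f"
proof -
  have "f \<in> borel_measurable lborel" and "integrable lborel (\<lambda>\<omega>. (norm (f \<omega>))\<^sup>2)"
    using assms by (simp_all add: square_integrable_def)
  moreover from this(2) have "integrable lborel (\<lambda>\<omega>. indicator {-pi..pi} \<omega> *\<^sub>R (norm (f \<omega>))\<^sup>2)"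
    by (rule integrable_mult_indicator[rotated]) simp
  ultimately show ?thesis
    unfolding square_integrable_def
    by (auto intro!: measurable_restrict_space1 simp: integrable_restrict_space)
qed

section \<open>Riemann sums over tagged divisions\<close>

text \<open>Each point of a cell lies within \<open>d\<close> of the tag, so a cell contributes an
  error of at most \<open>e\<close> times its length, and the lengths add up to
  \<open>b - a\<close>. The oscillation bound is a hypothesis, so that a single \<open>d\<close> can
  later be used for all frequencies at once.\<close>

lemma riemann_sum_error:
  fixes f :: "real \<Rightarrow> complex"
  assumes f: "continuous_on {a..b} f" and D: "D tagged_division_of {a..b}" "(\<lambda>t. ball t d) fine D"
    and osc: "\<And>x y. x \<in> {a..b} \<Longrightarrow> y \<in> {a..b} \<Longrightarrow> dist x y < d \<Longrightarrow> norm (f x - f y) \<le> e"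
    and ab: "a \<le> b"
  shows "norm ((\<Sum>(t, K)\<in>D. of_real (measure lborel K) * f t) - integral {a..b} f) \<le> e * (b - a)"
proof -
  have int: "f integrable_on {a..b}" using f by (rule integrable_continuous_real)
  have "integral {a..b} f = (\<Sum>(t, K)\<in>D. integral K f)"
    using integral_combine_tagged_division_topdown[of f a b D] int D by simp
  then have "(\<Sum>(t, K)\<in>D. of_real (measure lborel K) * f t) - integral {a..b} f
      = (\<Sum>(t, K)\<in>D. of_real (measure lborel K) * f t - integral K f)"
    by (simp add: sum_subtractf case_prod_unfold)
  also have "norm \<dots> \<le> (\<Sum>(t, K)\<in>D. e * measure lborel K)"
  proof (rule sum_norm_le, clarify)
    fix t K assume tK: "(t, K) \<in> D"
    obtain u v where K: "K = {u..v}"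
      using tagged_division_ofD(4)[OF D(1) tK] by (metis box_real(2))
    have sub: "K \<subseteq> {a..b}" "t \<in> K"
      using tagged_division_ofD(2,3)[OF D(1) tK] by auto
    have bl: "K \<subseteq> ball t d" using D(2) tK by (auto simp: fine_def)
    have le: "norm (f t - f x) \<le> e" if "x \<in> K" for x
      using that sub bl by (intro osc) auto
    moreover have "0 \<le> e" using order_trans[OF norm_ge_zero le[OF sub(2)]] .
    moreover have "((\<lambda>x. f t - f x) has_integral (measure lborel K *\<^sub>R f t - integral K f)) K"
      using integrable_on_subinterval[OF int] sub(1) unfolding K
      by (intro has_integral_diff has_integral_const_real integrable_integral) auto
    ultimately show "norm (of_real (measure lborel K) * f t - integral K f) \<le> e * measure lborel K"
      using has_integral_bound[of e "\<lambda>x. f t - f x" _ u v] unfolding K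
      by (simp add: scaleR_conv_of_real)
  qed
  also have "\<dots> = e * (\<Sum>(t, K)\<in>D. measure lborel K)"
    by (simp add: sum_distrib_left case_prod_unfold)
  also have "(\<Sum>(t, K)\<in>D. measure lborel K) = b - a"
    using additive_content_tagged_division[of D a b] D(1) ab by simp
  finally show ?thesis .
qed

text \<open>
  \<open>\<Phi>\<close> represents the random variable \<open>f\<close> in the spectral domain: some finite combinations
  \<open>\<Sum> a\<^sub>p X(t\<^sub>p)\<close> approximate \<open>f\<close> while the matching \<open>\<Sum> a\<^sub>p exp(-i\<omega>t\<^sub>p)\<close> approximate \<open>\<Phi>\<close>.
  The indices \<open>p\<close> are the tagged cells of a division, hence pairs with first component \<open>t\<^sub>p\<close>.
\<close>
definition spectral_pair ::
    "'a measure \<Rightarrow> (real \<Rightarrow> 'a \<Rightarrow> real) \<Rightarrow> ('a \<Rightarrow> real) \<Rightarrow> (real \<Rightarrow> complex) \<Rightarrow> bool"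
  where "spectral_pair P X f \<Phi> \<longleftrightarrow> square_integrable P f \<and> square_integrable band \<Phi> \<and>
    (\<forall>e>0. \<exists>(D :: (real \<times> real set) set) a. finite D \<and>
      (\<integral>x. ((\<Sum>p\<in>D. a p * X (fst p) x) - f x)\<^sup>2 \<partial>P) < e \<and>
      (\<integral>\<omega>. (norm ((\<Sum>p\<in>D. of_real (a p) * exp (- (\<i> * of_real (\<omega> * fst p)))) - \<Phi> \<omega>))\<^sup>2 \<partial>band) < e)"

section \<open>Isometry between random variables and spectral functions\<close>

text \<open>Choosing approximants for the tolerances 1 / (i + 1) gives sequences. What matters is
  that the same \<open>D i\<close> and \<open>a i\<close> serve both errors.\<close>

lemma null_sequences:
  fixes A B :: "'a \<Rightarrow> 'b \<Rightarrow> real"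
  assumes ex: "\<And>e. e > 0 \<Longrightarrow> \<exists>D a. A D a < e \<and> B D a < e"
    and nonneg: "\<And>D a. A D a \<ge> 0" "\<And>D a. B D a \<ge> 0"
  obtains D a where "(\<lambda>i. A (D i) (a i)) \<longlonglongrightarrow> 0" "(\<lambda>i. B (D i) (a i)) \<longlonglongrightarrow> 0"
proof -
  have "\<forall>i. \<exists>D a. A D a < inverse (real (Suc i)) \<and> B D a < inverse (real (Suc i))"
    by (simp add: ex)
  then obtain D a where *: "\<And>i. A (D i) (a i) < inverse (real (Suc i))"
      "\<And>i. B (D i) (a i) < inverse (real (Suc i))" by metis
  have "(\<lambda>i. A (D i) (a i)) \<longlonglongrightarrow> 0"
    by (rule real_tendsto_sandwich[OF _ _ tendsto_const LIMSEQ_inverse_real_of_nat])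
       (use *(1) nonneg in \<open>auto intro!: always_eventually less_imp_le\<close>)
  moreover have "(\<lambda>i. B (D i) (a i)) \<longlonglongrightarrow> 0"
    by (rule real_tendsto_sandwich[OF _ _ tendsto_const LIMSEQ_inverse_real_of_nat])
       (use *(2) nonneg in \<open>auto intro!: always_eventually less_imp_le\<close>)
  ultimately show ?thesis by (rule that)
qed

lemma spectral_pair_sequence:
  assumes "spectral_pair P X f \<Phi>"
  obtains D :: "nat \<Rightarrow> (real \<times> real set) set" and a where
    "(\<lambda>i. \<integral>x. (norm ((\<Sum>p\<in>D i. a i p * X (fst p) x) - f x))\<^sup>2 \<partial>P) \<longlonglongrightarrow> 0"
    "(\<lambda>i. \<integral>\<omega>. (norm ((\<Sum>p\<in>D i. of_real (a i p) * exp (- (\<i> * of_real (\<omega> * fst p)))) - \<Phi> \<omega>))\<^sup>2 \<partial>band)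
      \<longlonglongrightarrow> 0"
proof -
  let ?A = "\<lambda>(D :: (real \<times> real set) set) a. \<integral>x. (norm ((\<Sum>p\<in>D. a p * X (fst p) x) - f x))\<^sup>2 \<partial>P"
  let ?B = "\<lambda>(D :: (real \<times> real set) set) a.
    \<integral>\<omega>. (norm ((\<Sum>p\<in>D. of_real (a p) * exp (- (\<i> * of_real (\<omega> * fst p)))) - \<Phi> \<omega>))\<^sup>2 \<partial>band"
  have ex: "\<exists>D a. ?A D a < e \<and> ?B D a < e" if "e > 0" for e
    using assms that unfolding spectral_pair_def real_norm_def power2_abs by blast
  show ?thesis
    by (rule null_sequences[of ?A ?B, OF ex _ _ that]) simp_all
qed

text \<open>For finite combinations the claim is \<open>rep\<close> extended bilinearly. Both sides
  are continuous under mean-square convergence, the spectral side because \<gamma> is essentially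
  bounded, so the approximating sequences carry the identity over to \<open>f\<close> and
  \<open>g\<close>.\<close>

lemma spectral_isometry:
  assumes X: "\<And>t. square_integrable P (X t)"
    and \<gamma>: "\<gamma> \<in> borel_measurable band" "AE \<omega> in band. norm (\<gamma> \<omega>) \<le> C"
    and rep: "\<And>t s. complex_of_real (\<integral>x. X t x * X s x \<partial>P)
        = 1 / (2 * pi) * (\<integral>\<omega>. \<gamma> \<omega> * exp (\<i> * of_real (\<omega> * (t - s))) \<partial>band)"
    and f: "spectral_pair P X f \<Phi>" and g: "spectral_pair P X g \<Psi>"
  shows "complex_of_real (\<integral>x. f x * g x \<partial>P) = 1 / (2 * pi) * (\<integral>\<omega>. (\<gamma> \<omega> * cnj (\<Phi> \<omega>)) * \<Psi> \<omega> \<partial>band)"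
proof -
  let ?S = "\<lambda>D a x. \<Sum>p\<in>D. a p * X (fst p) x"
  let ?F = "\<lambda>(D::(real \<times> real set) set) a \<omega>. \<Sum>p\<in>D. complex_of_real (a p) * exp (- (\<i> * of_real (\<omega> * fst p)))"
  have sq: "square_integrable P f" "square_integrable P g"
      "square_integrable band \<Phi>" "square_integrable band \<Psi>"
    using f g by (auto simp: spectral_pair_def)
  have S: "square_integrable P (?S D a)" for D :: "(real \<times> real set) set" and a
    by (intro square_integrable_sum square_integrable_cmult X)
  have exp: "square_integrable band (\<lambda>\<omega>. exp (\<i> * of_real (\<omega> * t)))" for t
    by (rule square_integrable_band_bounded[where C = 1]) auto
  have "square_integrable band (\<lambda>\<omega>. exp (- (\<i> * of_real (\<omega> * t))))" for t
    using exp[of "-t"] by simp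
  then have F: "square_integrable band (?F D a)" for D a
    by (intro square_integrable_sum square_integrable_cmult)
  have cnj: "square_integrable band (\<lambda>\<omega>. cnj (h \<omega>))" if "square_integrable band h" for h
  proof -
    have "(\<lambda>\<omega>. cnj (h \<omega>)) \<in> borel_measurable band"
      using that by (intro measurable_compose[of h _ borel cnj])
        (auto simp: square_integrable_def intro!: borel_measurable_continuous_onI continuous_intros)
    then show ?thesis using that by (simp add: square_integrable_def)
  qed
  have \<gamma>cnj: "square_integrable band (\<lambda>\<omega>. \<gamma> \<omega> * cnj (h \<omega>))" if "square_integrable band h" for h
    by (rule square_integrable_mult_bounded[OF cnj[OF that] \<gamma>])
  have \<gamma>exp: "integrable band (\<lambda>\<omega>. \<gamma> \<omega> * exp (\<i> * of_real (\<omega> * t)))" for t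
  proof -
    have "square_integrable band (\<lambda>\<omega>. \<gamma> \<omega> * exp (\<i> * of_real (\<omega> * t)))"
      by (rule square_integrable_mult_bounded[OF exp \<gamma>])
    moreover have "square_integrable band (\<lambda>_. 1 :: complex)"
      by (rule square_integrable_band_bounded[where C = 1]) auto
    ultimately show ?thesis using square_integrable_integrable_mult by fastforce
  qed
  \<comment> \<open>Expanding both sums reduces this to the covariances of pairs of values of
    \<open>X\<close>. All terms on the spectral side are integrable, so the finite sums and the
    integral may be exchanged.\<close>
  have fin: "complex_of_real (\<integral>x. ?S D a x * ?S D' a' x \<partial>P)
      = 1 / (2 * pi) * (\<integral>\<omega>. (\<gamma> \<omega> * cnj (?F D a \<omega>)) * ?F D' a' \<omega> \<partial>band)"
    for D D' :: "(real \<times> real set) set" and a a'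
  proof -
    have "(\<integral>x. ?S D a x * ?S D' a' x \<partial>P)
        = (\<integral>x. (\<Sum>p\<in>D. \<Sum>q\<in>D'. (a p * a' q) * (X (fst p) x * X (fst q) x)) \<partial>P)"
      unfolding sum_product by (simp only: mult_ac)
    also have "\<dots> = (\<Sum>p\<in>D. \<Sum>q\<in>D'. (a p * a' q) * (\<integral>x. X (fst p) x * X (fst q) x \<partial>P))"
      using square_integrable_integrable_mult[OF X X] by simp
    finally have "complex_of_real (\<integral>x. ?S D a x * ?S D' a' x \<partial>P)
        = (\<Sum>p\<in>D. \<Sum>q\<in>D'. of_real (a p * a' q) *
            (1 / (2 * pi) * (\<integral>\<omega>. \<gamma> \<omega> * exp (\<i> * of_real (\<omega> * (fst p - fst q))) \<partial>band)))"
      by (simp only: of_real_sum of_real_mult rep)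
    also have "\<dots> = 1 / (2 * pi) * (\<Sum>p\<in>D. \<Sum>q\<in>D'. of_real (a p * a' q) *
            (\<integral>\<omega>. \<gamma> \<omega> * exp (\<i> * of_real (\<omega> * (fst p - fst q))) \<partial>band))"
      unfolding sum_distrib_left by (intro sum.cong refl) (simp only: mult_ac)
    also have "(\<Sum>p\<in>D. \<Sum>q\<in>D'. of_real (a p * a' q) *
            (\<integral>\<omega>. \<gamma> \<omega> * exp (\<i> * of_real (\<omega> * (fst p - fst q))) \<partial>band))
        = (\<integral>\<omega>. (\<Sum>p\<in>D. \<Sum>q\<in>D'. of_real (a p * a' q) *
            (\<gamma> \<omega> * exp (\<i> * of_real (\<omega> * (fst p - fst q))))) \<partial>band)"
      using \<gamma>exp by (simp del: of_real_mult of_real_diff)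
    also have "\<dots> = (\<integral>\<omega>. (\<gamma> \<omega> * cnj (?F D a \<omega>)) * ?F D' a' \<omega> \<partial>band)"
    proof (rule Bochner_Integration.integral_cong[OF refl])
      fix \<omega>
      \<comment> \<open>The sign convention exp(-i\<omega>t) for \<open>X t\<close> forces the
        conjugate onto the first factor.\<close>
      have e: "exp (\<i> * of_real (\<omega> * (t - s)))
          = cnj (exp (- (\<i> * of_real (\<omega> * t)))) * exp (- (\<i> * of_real (\<omega> * s)))" for t s
        by (simp add: exp_cnj right_diff_distrib flip: exp_add)
      have "\<gamma> \<omega> * cnj (?F D a \<omega>) * ?F D' a' \<omega> = \<gamma> \<omega> * (\<Sum>p\<in>D. \<Sum>q\<in>D'.
          (of_real (a p) * cnj (exp (- (\<i> * of_real (\<omega> * fst p))))) *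
          (of_real (a' q) * exp (- (\<i> * of_real (\<omega> * fst q)))))"
        by (simp only: cnj_sum complex_cnj_mult complex_cnj_complex_of_real mult.assoc sum_product)
      then show "(\<Sum>p\<in>D. \<Sum>q\<in>D'. of_real (a p * a' q) *
            (\<gamma> \<omega> * exp (\<i> * of_real (\<omega> * (fst p - fst q)))))
          = (\<gamma> \<omega> * cnj (?F D a \<omega>)) * ?F D' a' \<omega>"
        unfolding e sum_distrib_left by (simp only: of_real_mult mult_ac)
    qed
    finally show ?thesis .
  qed
  obtain D a where Dlim: "(\<lambda>i. \<integral>x. (norm (?S (D i) (a i) x - f x))\<^sup>2 \<partial>P) \<longlonglongrightarrow> 0"
      "(\<lambda>i. \<integral>\<omega>. (norm (?F (D i) (a i) \<omega> - \<Phi> \<omega>))\<^sup>2 \<partial>band) \<longlonglongrightarrow> 0"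
    using f by (rule spectral_pair_sequence)
  obtain D' a' where D'lim: "(\<lambda>i. \<integral>x. (norm (?S (D' i) (a' i) x - g x))\<^sup>2 \<partial>P) \<longlonglongrightarrow> 0"
      "(\<lambda>i. \<integral>\<omega>. (norm (?F (D' i) (a' i) \<omega> - \<Psi> \<omega>))\<^sup>2 \<partial>band) \<longlonglongrightarrow> 0"
    using g by (rule spectral_pair_sequence)
  have "(\<lambda>i. \<integral>x. ?S (D i) (a i) x * ?S (D' i) (a' i) x \<partial>P) \<longlonglongrightarrow> (\<integral>x. f x * g x \<partial>P)"
    by (rule tendsto_integral_mult[OF sq(1,2) _ _ Dlim(1) D'lim(1)]) (simp_all add: S)
  then have L1: "(\<lambda>i. complex_of_real (\<integral>x. ?S (D i) (a i) x * ?S (D' i) (a' i) x \<partial>P))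
      \<longlonglongrightarrow> complex_of_real (\<integral>x. f x * g x \<partial>P)"
    by (rule tendsto_of_real)
  \<comment> \<open>The weight is absorbed into the first factor of the pairing. Multiplication by
    \<gamma> enlarges the squared mean-square distance by at most \<open>C\<^sup>2\<close>.\<close>
  have \<gamma>lim: "(\<lambda>i. \<integral>\<omega>. (norm (\<gamma> \<omega> * cnj (?F (D i) (a i) \<omega>) - \<gamma> \<omega> * cnj (\<Phi> \<omega>)))\<^sup>2 \<partial>band) \<longlonglongrightarrow> 0"
  proof (rule real_tendsto_sandwich[OF _ _ tendsto_const])
    show "(\<lambda>i. C\<^sup>2 * (\<integral>\<omega>. (norm (?F (D i) (a i) \<omega> - \<Phi> \<omega>))\<^sup>2 \<partial>band)) \<longlonglongrightarrow> 0"
      using tendsto_mult[OF tendsto_const[of "C\<^sup>2"] Dlim(2)] by simp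
    have "(\<integral>\<omega>. (norm (\<gamma> \<omega> * cnj (?F (D i) (a i) \<omega>) - \<gamma> \<omega> * cnj (\<Phi> \<omega>)))\<^sup>2 \<partial>band)
        \<le> (\<integral>\<omega>. C\<^sup>2 * (norm (?F (D i) (a i) \<omega> - \<Phi> \<omega>))\<^sup>2 \<partial>band)" for i
    proof (rule integral_mono_AE)
      show "integrable band (\<lambda>\<omega>. (norm (\<gamma> \<omega> * cnj (?F (D i) (a i) \<omega>) - \<gamma> \<omega> * cnj (\<Phi> \<omega>)))\<^sup>2)"
        using square_integrable_diff[OF \<gamma>cnj[OF F] \<gamma>cnj[OF sq(3)]] by (simp add: square_integrable_def)
      show "integrable band (\<lambda>\<omega>. C\<^sup>2 * (norm (?F (D i) (a i) \<omega> - \<Phi> \<omega>))\<^sup>2)"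
        using square_integrable_diff[OF F sq(3)] by (simp add: square_integrable_def)
      show "AE \<omega> in band. (norm (\<gamma> \<omega> * cnj (?F (D i) (a i) \<omega>) - \<gamma> \<omega> * cnj (\<Phi> \<omega>)))\<^sup>2
          \<le> C\<^sup>2 * (norm (?F (D i) (a i) \<omega> - \<Phi> \<omega>))\<^sup>2"
        using \<gamma>(2)
      proof eventually_elim
        case (elim \<omega>)
        have "norm (\<gamma> \<omega> * cnj (?F (D i) (a i) \<omega>) - \<gamma> \<omega> * cnj (\<Phi> \<omega>))
            = norm (\<gamma> \<omega>) * norm (?F (D i) (a i) \<omega> - \<Phi> \<omega>)"
          by (simp only: complex_mod_cnj norm_mult flip: right_diff_distrib complex_cnj_diff)
        then show ?case
          using elim by (simp add: power_mult_distrib mult_right_mono power_mono)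
      qed
    qed
    then show "eventually (\<lambda>i. (\<integral>\<omega>. (norm (\<gamma> \<omega> * cnj (?F (D i) (a i) \<omega>) - \<gamma> \<omega> * cnj (\<Phi> \<omega>)))\<^sup>2 \<partial>band)
        \<le> C\<^sup>2 * (\<integral>\<omega>. (norm (?F (D i) (a i) \<omega> - \<Phi> \<omega>))\<^sup>2 \<partial>band)) sequentially"
      by simp
  qed simp
  have "(\<lambda>i. \<integral>\<omega>. (\<gamma> \<omega> * cnj (?F (D i) (a i) \<omega>)) * ?F (D' i) (a' i) \<omega> \<partial>band)
      \<longlonglongrightarrow> (\<integral>\<omega>. (\<gamma> \<omega> * cnj (\<Phi> \<omega>)) * \<Psi> \<omega> \<partial>band)"
    by (rule tendsto_integral_mult[OF \<gamma>cnj[OF sq(3)] sq(4) _ _ \<gamma>lim D'lim(2)])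
       (intro always_eventually allI \<gamma>cnj F)+
  then have L2: "(\<lambda>i. complex_of_real (\<integral>x. ?S (D i) (a i) x * ?S (D' i) (a' i) x \<partial>P))
      \<longlonglongrightarrow> 1 / (2 * pi) * (\<integral>\<omega>. (\<gamma> \<omega> * cnj (\<Phi> \<omega>)) * \<Psi> \<omega> \<partial>band)"
    unfolding fin by (rule tendsto_mult[OF tendsto_const])
  show ?thesis by (rule LIMSEQ_unique[OF L1 L2])
qed

section \<open>Mean-square integrals in the spectral domain\<close>

lemma square_integrable_ms_line:
  "has_ms_integral_line P Y I \<Longrightarrow> square_integrable P I"
  by (simp add: has_ms_integral_line_def)

lemma integral_add_square_less:
  fixes f g :: "'a \<Rightarrow> 'b::{real_normed_field,second_countable_topology}"
  assumes f: "square_integrable N f" and g: "square_integrable N g"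
    and "2 * (\<integral>x. (norm (f x))\<^sup>2 \<partial>N) + 2 * (\<integral>x. (norm (g x))\<^sup>2 \<partial>N) < e"
  shows "(\<integral>x. (norm (f x + g x))\<^sup>2 \<partial>N) < e"
proof -
  have "(\<integral>x. (norm (f x + g x))\<^sup>2 \<partial>N) \<le> (\<integral>x. 2 * (norm (f x))\<^sup>2 + 2 * (norm (g x))\<^sup>2 \<partial>N)"
    using f g square_integrable_add[OF f g]
    by (intro integral_mono) (auto simp: square_integrable_def norm_add_square_le)
  also have "\<dots> = 2 * (\<integral>x. (norm (f x))\<^sup>2 \<partial>N) + 2 * (\<integral>x. (norm (g x))\<^sup>2 \<partial>N)"
    using f g by (simp add: square_integrable_def)
  finally show ?thesis using assms(3) by linarith
qed

lemma integral_band_le: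
  fixes h :: "real \<Rightarrow> real"
  assumes h: "integrable lborel h" and nonneg: "\<And>\<omega>. h \<omega> \<ge> 0"
  shows "(\<integral>\<omega>. h \<omega> \<partial>band) \<le> (\<integral>\<omega>. h \<omega> \<partial>lborel)"
proof -
  have "(\<integral>\<omega>. h \<omega> \<partial>band) = (\<integral>\<omega>. indicator {-pi..pi} \<omega> *\<^sub>R h \<omega> \<partial>lborel)"
    by (rule integral_restrict_space) simp
  also have "\<dots> \<le> (\<integral>\<omega>. h \<omega> \<partial>lborel)"
    by (intro integral_mono integrable_mult_indicator h) (use nonneg in \<open>auto simp: indicator_def\<close>)
  finally show ?thesis .
qed

text \<open>The modulated function is continuous jointly in frequency and time on a compact
  rectangle. Uniform continuity there gives one \<open>d\<close> that is valid for every \<omega> in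
  the band.\<close>

lemma uniformly_continuous_modulated:
  fixes w :: "real \<Rightarrow> real"
  assumes w: "continuous_on UNIV w" and "e > 0"
  obtains d where "d > 0"
    "\<And>\<omega> x y. \<omega> \<in> {-pi..pi} \<Longrightarrow> x \<in> {a..b} \<Longrightarrow> y \<in> {a..b} \<Longrightarrow> dist x y < d \<Longrightarrow>
      norm (of_real (w x) * exp (- (\<i> * of_real (\<omega> * x))) - of_real (w y) * exp (- (\<i> * of_real (\<omega> * y)))) \<le> e"
proof -
  let ?f = "\<lambda>(\<omega>, t). complex_of_real (w t) * exp (- (\<i> * of_real (\<omega> * t)))"
  have "continuous_on ({-pi..pi} \<times> {a..b}) ?f"
    unfolding case_prod_unfold
    by (intro continuous_intros continuous_on_compose2[OF w]) auto
  then have "uniformly_continuous_on ({-pi..pi} \<times> {a..b}) ?f"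
    by (intro compact_uniformly_continuous compact_Times) auto
  then obtain d where d: "d > 0" "\<And>p q. p \<in> {-pi..pi} \<times> {a..b} \<Longrightarrow> q \<in> {-pi..pi} \<times> {a..b} \<Longrightarrow>
      dist q p < d \<Longrightarrow> dist (?f q) (?f p) < e"
    using \<open>e > 0\<close> unfolding uniformly_continuous_on_def by blast
  show ?thesis
  proof (rule that[OF d(1)])
    fix \<omega> x y assume "\<omega> \<in> {-pi..pi}" "x \<in> {a..b}" "y \<in> {a..b}" "dist x y < d"
    then show "norm (of_real (w x) * exp (- (\<i> * of_real (\<omega> * x))) - of_real (w y) * exp (- (\<i> * of_real (\<omega> * y)))) \<le> e"
      using d(2)[of "(\<omega>, y)" "(\<omega>, x)"] by (simp add: dist_Pair_Pair dist_norm)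
  qed
qed

text \<open>Translation by \<open>s\<close> produces the phase and recentres the interval at 0,
  which gives the truncation used in \<open>has_fourier_transform\<close>. The left side is a gauge
  integral, as Riemann sums require, and the right side a Lebesgue integral.\<close>

lemma integral_modulated_shift:
  fixes w :: "real \<Rightarrow> real"
  assumes w: "continuous_on UNIV w"
  shows "integral {-T + s..T + s} (\<lambda>t. of_real (w (t - s)) * exp (- (\<i> * of_real (\<omega> * t))))
    = exp (- (\<i> * of_real (\<omega> * s))) * (LINT t:{-T..T}|lborel. of_real (w t) * exp (- (\<i> * of_real (\<omega> * t))))"
proof -
  let ?f = "\<lambda>t. complex_of_real (w t) * exp (- (\<i> * of_real (\<omega> * t)))"
  have "continuous_on {-T..T} ?f"
    by (intro continuous_intros continuous_on_subset[OF w]) auto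
  then have "set_integrable lborel {-T..T} ?f" by (rule borel_integrable_atLeastAtMost')
  then have "(LINT t:{-T..T}|lborel. ?f t) = integral {-T..T} ?f"
    by (rule set_borel_integral_eq_integral)
  then have "exp (- (\<i> * of_real (\<omega> * s))) * (LINT t:{-T..T}|lborel. ?f t)
      = integral {-T..T} (\<lambda>t. exp (- (\<i> * of_real (\<omega> * s))) * ?f t)"
    by simp
  also have "(\<lambda>t. exp (- (\<i> * of_real (\<omega> * s))) * ?f t)
      = (\<lambda>t. of_real (w (t - s)) * exp (- (\<i> * of_real (\<omega> * t)))) \<circ> ((+) s)"
    by (rule ext) (simp add: distrib_left exp_add exp_minus)
  also have "integral {-T..T} \<dots> = integral {-T + s..T + s} (\<lambda>t. of_real (w (t - s)) * exp (- (\<i> * of_real (\<omega> * t))))"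
    by (rule integral_shift_Icc_real)
  finally show ?thesis ..
qed

text \<open>The same weights \<open>measure lborel K * w (t - s)\<close> form Riemann sums on both
  sides: with \<open>X t\<close> they approximate the integral over a finite interval in mean
  square, and with exp(-i\<omega>t) they approximate the phase times the truncated transform,
  uniformly on the band. Long intervals bring the first close to \<open>c\<close> and the second
  close to the phase times \<Phi>.\<close>

lemma spectral_pair_ms_integral_line:
  fixes w :: "real \<Rightarrow> real"
  assumes X: "\<And>t. square_integrable P (X t)"
    and w: "continuous_on UNIV w"
    and ft: "has_fourier_transform (\<lambda>t. of_real (w t)) \<Phi>"
    and c: "has_ms_integral_line P (\<lambda>t x. X t x * w (t - s)) c"
  shows "spectral_pair P X c (\<lambda>\<omega>. exp (- (\<i> * of_real (\<omega> * s))) * \<Phi> \<omega>)"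
proof -
  let ?E = "\<lambda>\<omega>. exp (- (\<i> * complex_of_real (\<omega> * s)))"
  have s\<Phi>: "square_integrable lborel \<Phi>" using ft by (simp add: has_fourier_transform_def)
  then have [measurable]: "\<Phi> \<in> borel_measurable borel" by (simp add: square_integrable_def)
  have [measurable]: "w \<in> borel_measurable borel"
    using w by (rule borel_measurable_continuous_onI)
  define G where "G T \<omega> = (LINT t:{-T..T}|lborel. of_real (w t) * exp (- (\<i> * complex_of_real (\<omega> * t))))" for T \<omega>
  have [measurable]: "G T \<in> borel_measurable borel" for T
    unfolding G_def[abs_def] set_lebesgue_integral_def by measurable
  have E\<Phi>: "square_integrable band (\<lambda>\<omega>. ?E \<omega> * \<Phi> \<omega>)"
    by (rule square_integrable_band, rule square_integrable_mult_bounded[OF s\<Phi>, where C = 1]) auto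
  obtain J where J: "\<And>a b. a \<le> b \<Longrightarrow> has_ms_integral P (\<lambda>t x. X t x * w (t - s)) a b (J a b)"
    and Jlim: "((\<lambda>(a, b). \<integral>x. (J a b x - c x)\<^sup>2 \<partial>P) \<longlongrightarrow> 0) (at_bot \<times>\<^sub>F at_top)"
    using c unfolding has_ms_integral_line_def by blast
  have sc: "square_integrable P c" using c by (rule square_integrable_ms_line)
  \<comment> \<open>The two free end points are specialised to intervals symmetric about
    \<open>s\<close>, which become [-T, T] after the shift by \<open>s\<close>.\<close>
  have "filterlim (\<lambda>T. (-T + s, T + s)) (at_bot \<times>\<^sub>F at_top) at_top"
  proof (rule filterlim_Pair)
    show "filterlim (\<lambda>T. -T + s) at_bot at_top"
      unfolding filterlim_at_bot
    proof
      fix Z show "eventually (\<lambda>T. -T + s \<le> Z) at_top"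
        using eventually_ge_at_top[of "s - Z"] by eventually_elim simp
    qed
    show "filterlim (\<lambda>T. T + s) at_top at_top"
      unfolding filterlim_at_top
    proof
      fix Z show "eventually (\<lambda>T. Z \<le> T + s) at_top"
        using eventually_ge_at_top[of "Z - s"] by eventually_elim simp
    qed
  qed
  from filterlim_compose[OF Jlim this]
  have Jlim': "((\<lambda>T. \<integral>x. (J (-T + s) (T + s) x - c x)\<^sup>2 \<partial>P) \<longlongrightarrow> 0) at_top" by simp
  have Glim: "((\<lambda>T. \<integral>\<^sup>+\<omega>. ennreal ((norm (\<Phi> \<omega> - G T \<omega>))\<^sup>2) \<partial>lborel) \<longlongrightarrow> 0) at_top"
    using ft unfolding has_fourier_transform_def G_def by simp
  show ?thesis
    unfolding spectral_pair_def
  proof (intro conjI sc E\<Phi> allI impI)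
    fix e :: real assume e: "e > 0"
    \<comment> \<open>Each of two errors enters \<open>integral_add_square_less\<close> with a
      factor 2, hence the shares \<open>e / 4\<close>.\<close>
    have "eventually (\<lambda>T. (\<integral>x. (J (-T + s) (T + s) x - c x)\<^sup>2 \<partial>P) < e / 4 \<and>
        (\<integral>\<^sup>+\<omega>. ennreal ((norm (\<Phi> \<omega> - G T \<omega>))\<^sup>2) \<partial>lborel) < ennreal (e / 4) \<and> T > 0) at_top"
      by (intro eventually_conj order_tendstoD(2)[OF Jlim'] order_tendstoD(2)[OF Glim] eventually_gt_at_top)
         (use e in auto)
    from eventually_happens[OF this] obtain T where
      T1: "(\<integral>x. (J (-T + s) (T + s) x - c x)\<^sup>2 \<partial>P) < e / 4" and
      T2: "(\<integral>\<^sup>+\<omega>. ennreal ((norm (\<Phi> \<omega> - G T \<omega>))\<^sup>2) \<partial>lborel) < ennreal (e / 4)" and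
      T: "T > 0" by auto
    define a b where "a = -T + s" and "b = T + s"
    have ab: "a \<le> b" "b - a = 2 * T" using T by (auto simp: a_def b_def)
    have ms: "has_ms_integral P (\<lambda>t x. X t x * w (t - s)) a b (J a b)" by (rule J[OF ab(1)])
    then have sJ: "square_integrable P (J a b)" by (simp add: has_ms_integral_def)
    obtain d1 where d1: "d1 > 0" "\<And>D. D tagged_division_of {a..b} \<Longrightarrow> (\<lambda>t. ball t d1) fine D \<Longrightarrow>
        (\<integral>x. ((\<Sum>(t, K)\<in>D. measure lborel K * (X t x * w (t - s))) - J a b x)\<^sup>2 \<partial>P) < e / 4"
      using ms[unfolded has_ms_integral_def, THEN conjunct2, THEN spec, of "e / 4"] e by auto
    \<comment> \<open>\<open>\<delta>\<close> is the error allowed uniformly on the band. Its square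
      integrates to \<open>e / 8\<close> there because the band has length 2 pi. On an interval of
      length \<open>2 * T\<close> the oscillation allowed within a cell is therefore
      \<open>\<delta> / (2 * T)\<close>.\<close>
    define \<delta> where "\<delta> = sqrt (e / (16 * pi))"
    have \<delta>: "\<delta> > 0" "\<delta>\<^sup>2 = e / (16 * pi)" using e by (auto simp: \<delta>_def)
    have w': "continuous_on UNIV (\<lambda>t. w (t - s))"
      by (intro continuous_on_compose2[OF w] continuous_intros) auto
    obtain d2 where d2: "d2 > 0"
      "\<And>\<omega> x y. \<omega> \<in> {-pi..pi} \<Longrightarrow> x \<in> {a..b} \<Longrightarrow> y \<in> {a..b} \<Longrightarrow> dist x y < d2 \<Longrightarrow>
        norm (of_real (w (x - s)) * exp (- (\<i> * of_real (\<omega> * x)))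
            - of_real (w (y - s)) * exp (- (\<i> * of_real (\<omega> * y)))) \<le> \<delta> / (2 * T)"
      using uniformly_continuous_modulated[OF w', of "\<delta> / (2 * T)" a b] \<delta>(1) T by auto
    \<comment> \<open>One division has to be fine enough for the random and for the spectral Riemann
      sum, since a spectral pair demands common coefficients.\<close>
    obtain D where D: "D tagged_division_of {a..b}" "(\<lambda>t. ball t (min d1 d2)) fine D"
      using fine_division_exists_real[of "\<lambda>t. ball t (min d1 d2)" a b] d1(1) d2(1)
      by (auto simp: gauge_def)
    have fine1: "(\<lambda>t. ball t d1) fine D" and fine2: "(\<lambda>t. ball t d2) fine D"
      using D(2) unfolding fine_def ball_min_Int by blast+
    \<comment> \<open>The values of \<open>w\<close> are put into the coefficients, so that
      \<open>X t\<close> and exp(-i\<omega>t) are exchanged without touching them.\<close>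
    define A where "A p = measure lborel (snd p) * w (fst p - s)" for p :: "real \<times> real set"
    let ?S = "\<lambda>x. \<Sum>p\<in>D. A p * X (fst p) x"
    let ?F = "\<lambda>\<omega>. \<Sum>p\<in>D. complex_of_real (A p) * exp (- (\<i> * of_real (\<omega> * fst p)))"
    have "finite D" using D(1) by blast
    moreover have "(\<integral>x. (?S x - c x)\<^sup>2 \<partial>P) < e"
    proof -
      have sS: "square_integrable P ?S"
        by (intro square_integrable_sum square_integrable_cmult X)
      have "(\<Sum>(t, K)\<in>D. measure lborel K * (X t x * w (t - s))) = ?S x" for x
        by (simp add: A_def case_prod_unfold mult_ac)
      with d1(2)[OF D(1) fine1] have "(\<integral>x. (norm (?S x - J a b x))\<^sup>2 \<partial>P) < e / 4" by simp
      moreover have "(\<integral>x. (norm (J a b x - c x))\<^sup>2 \<partial>P) < e / 4"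
        using T1 by (simp add: a_def b_def)
      ultimately have "(\<integral>x. (norm ((?S x - J a b x) + (J a b x - c x)))\<^sup>2 \<partial>P) < e"
        by (intro integral_add_square_less square_integrable_diff sS sJ sc) linarith
      then show ?thesis by simp
    qed
    moreover have "(\<integral>\<omega>. (norm (?F \<omega> - ?E \<omega> * \<Phi> \<omega>))\<^sup>2 \<partial>band) < e"
    proof -
      \<comment> \<open>On the spectral side the sum is a Riemann sum for the modulated
        \<open>w\<close> over the interval centred at \<open>s\<close>. The integral itself equals
        the phase times \<open>G T \<omega>\<close>.\<close>
      have close: "norm (?F \<omega> - ?E \<omega> * G T \<omega>) \<le> \<delta>" if \<omega>: "\<omega> \<in> {-pi..pi}" for \<omega>
      proof -
        let ?f = "\<lambda>t. complex_of_real (w (t - s)) * exp (- (\<i> * of_real (\<omega> * t)))"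
        have "norm ((\<Sum>(t, K)\<in>D. of_real (measure lborel K) * ?f t) - integral {a..b} ?f) \<le> \<delta> / (2 * T) * (b - a)"
        proof (rule riemann_sum_error[OF _ D(1) fine2 _ ab(1)])
          show "continuous_on {a..b} ?f"
            by (intro continuous_intros continuous_on_subset[OF w']) auto
        qed (rule d2(2)[OF \<omega>])
        moreover have "(\<Sum>(t, K)\<in>D. of_real (measure lborel K) * ?f t) = ?F \<omega>"
          by (simp add: A_def case_prod_unfold mult_ac)
        moreover have "integral {a..b} ?f = ?E \<omega> * G T \<omega>"
          unfolding a_def b_def G_def by (rule integral_modulated_shift[OF w])
        ultimately show ?thesis using ab(2) T by simp
      qed
      have d\<Phi>: "integrable lborel (\<lambda>\<omega>. (norm (\<Phi> \<omega> - G T \<omega>))\<^sup>2)"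
        using T2 by (auto simp: integrable_iff_bounded intro: order_less_trans)
      have "ennreal (\<integral>\<omega>. (norm (\<Phi> \<omega> - G T \<omega>))\<^sup>2 \<partial>lborel) < ennreal (e / 4)"
        using T2 nn_integral_eq_integral[OF d\<Phi>] by simp
      then have lt: "(\<integral>\<omega>. (norm (\<Phi> \<omega> - G T \<omega>))\<^sup>2 \<partial>lborel) < e / 4"
        by (simp add: ennreal_less_iff)
      have "(\<integral>\<omega>. (norm (?E \<omega> * G T \<omega> - ?E \<omega> * \<Phi> \<omega>))\<^sup>2 \<partial>band) = (\<integral>\<omega>. (norm (\<Phi> \<omega> - G T \<omega>))\<^sup>2 \<partial>band)"
        by (simp add: norm_mult norm_minus_commute flip: right_diff_distrib)
      also have "\<dots> \<le> (\<integral>\<omega>. (norm (\<Phi> \<omega> - G T \<omega>))\<^sup>2 \<partial>lborel)"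
        by (rule integral_band_le[OF d\<Phi>]) simp
      finally have B2: "(\<integral>\<omega>. (norm (?E \<omega> * G T \<omega> - ?E \<omega> * \<Phi> \<omega>))\<^sup>2 \<partial>band) < e / 4"
        using lt by linarith
      have "square_integrable lborel (\<lambda>\<omega>. \<Phi> \<omega> - G T \<omega>)"
        using d\<Phi> by (simp add: square_integrable_def)
      from square_integrable_diff[OF s\<Phi> this] have "square_integrable lborel (G T)" by simp
      then have EG: "square_integrable band (\<lambda>\<omega>. ?E \<omega> * G T \<omega>)"
        by (intro square_integrable_band square_integrable_mult_bounded[where C = 1]) auto
      have F: "square_integrable band ?F"
        by (intro square_integrable_sum square_integrable_cmult square_integrable_band_bounded[where C = 1]) auto
      have FG: "square_integrable band (\<lambda>\<omega>. ?F \<omega> - ?E \<omega> * G T \<omega>)"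
        by (rule square_integrable_diff[OF F EG])
      have "(\<integral>\<omega>. (norm (?F \<omega> - ?E \<omega> * G T \<omega>))\<^sup>2 \<partial>band) \<le> (\<integral>\<omega>. \<delta>\<^sup>2 \<partial>band)"
      proof (rule integral_mono)
        show "integrable band (\<lambda>\<omega>. \<delta>\<^sup>2)" by (rule integrable_band_bounded) auto
      qed (use FG close in \<open>auto simp: square_integrable_def intro!: power_mono\<close>)
      also have "\<dots> = e / 8"
        using measure_band by (simp add: \<delta>(2))
      finally have B1: "(\<integral>\<omega>. (norm (?F \<omega> - ?E \<omega> * G T \<omega>))\<^sup>2 \<partial>band) \<le> e / 8" .
      have "(\<integral>\<omega>. (norm ((?F \<omega> - ?E \<omega> * G T \<omega>) + (?E \<omega> * G T \<omega> - ?E \<omega> * \<Phi> \<omega>)))\<^sup>2 \<partial>band) < e"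
        using B1 B2 e
        by (intro integral_add_square_less FG square_integrable_diff EG E\<Phi>) linarith
      then show ?thesis by simp
    qed
    ultimately show "\<exists>(D :: (real \<times> real set) set) a. finite D \<and>
      (\<integral>x. ((\<Sum>p\<in>D. a p * X (fst p) x) - c x)\<^sup>2 \<partial>P) < e \<and>
      (\<integral>\<omega>. (norm ((\<Sum>p\<in>D. of_real (a p) * exp (- (\<i> * of_real (\<omega> * fst p)))) - ?E \<omega> * \<Phi> \<omega>))\<^sup>2 \<partial>band) < e"
      by blast
  qed
qed

section \<open>Autocorrelation of the packet coefficients\<close>

lemma wide_sense_stationary_l2norm:
  assumes "wide_sense_stationary P X"
  shows "l2norm P (X t) = l2norm P (X 0)"
proof -
  have "(\<integral>x. X (0 + t) x * X (0 + t) x \<partial>P) = (\<integral>x. X 0 x * X 0 x \<partial>P)"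
    using assms unfolding wide_sense_stationary_def by blast
  then show ?thesis by (simp add: l2norm_def power2_eq_square)
qed

lemma autocorrelation_bounded:
  assumes ws: "wide_sense_stationary P X"
  shows "\<bar>autocorrelation P X t\<bar> \<le> (l2norm P (X 0))\<^sup>2"
proof -
  have "square_integrable P (X t)" for t
    using ws by (simp add: wide_sense_stationary_def second_order_def)
  from Cauchy_Schwarz_integral[OF this this, of t 0] show ?thesis
    by (simp add: autocorrelation_def wide_sense_stationary_l2norm[OF ws, of t] power2_eq_square)
qed

text \<open>The increment of the autocorrelation is E[(X(t) - X(s)) X(0)], which Cauchy-Schwarz
  bounds by the quadratic-mean increment of \<open>X\<close>. Inversion at every point relies on
  this continuity.\<close>

lemma continuous_autocorrelation:
  assumes so: "second_order P X" and qm: "continuous_in_quadratic_mean P X"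
  shows "continuous_on UNIV (autocorrelation P X)"
  unfolding continuous_on_def
proof safe
  fix s :: real
  have X: "square_integrable P (X t)" for t using so by (simp add: second_order_def)
  have "((\<lambda>t. autocorrelation P X t - autocorrelation P X s) \<longlongrightarrow> 0) (at s)"
  proof (rule Lim_null_comparison)
    have "norm (autocorrelation P X t - autocorrelation P X s)
        \<le> l2norm P (\<lambda>x. X t x - X s x) * l2norm P (X 0)" for t
    proof -
      have "autocorrelation P X t - autocorrelation P X s = (\<integral>x. (X t x - X s x) * X 0 x \<partial>P)"
        using square_integrable_integrable_mult[OF X X]
        by (simp add: autocorrelation_def left_diff_distrib)
      then show ?thesis
        using Cauchy_Schwarz_integral[OF square_integrable_diff[OF X X] X] by simp
    qed
    then show "eventually (\<lambda>t. norm (autocorrelation P X t - autocorrelation P X s)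
        \<le> l2norm P (\<lambda>x. X t x - X s x) * l2norm P (X 0)) (at s)" by simp
    have "((\<lambda>t. l2norm P (\<lambda>x. X t x - X s x)) \<longlongrightarrow> sqrt 0) (at s)"
      unfolding l2norm_def real_norm_def power2_abs
      using qm by (intro tendsto_real_sqrt) (simp add: continuous_in_quadratic_mean_def)
    then show "((\<lambda>t. l2norm P (\<lambda>x. X t x - X s x) * l2norm P (X 0)) \<longlongrightarrow> 0) (at s)"
      by (intro tendsto_mult_left_zero) simp
  qed
  then show "(autocorrelation P X \<longlongrightarrow> autocorrelation P X s) (at s)" by (rule LIM_zero_cancel)
qed

lemma integrable_band_supported:
  assumes [measurable]: "\<gamma> \<in> borel_measurable borel" and bd: "AE \<omega> in lborel. norm (\<gamma> \<omega>) \<le> C"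
    and supp: "supported_within {-pi..pi} \<gamma>"
  shows "integrable lborel \<gamma>"
proof (rule Bochner_Integration.integrable_bound)
  show "integrable lborel (\<lambda>\<omega>. indicator {-pi..pi} \<omega> * C)" by simp
  show "AE \<omega> in lborel. norm (\<gamma> \<omega>) \<le> norm (indicator {-pi..pi} \<omega> * C)"
    using bd supp[unfolded supported_within_def]
    by eventually_elim (auto simp: indicator_def)
qed simp

lemma integral_band_supported:
  fixes \<gamma> f :: "real \<Rightarrow> complex"
  assumes [measurable]: "\<gamma> \<in> borel_measurable borel" "f \<in> borel_measurable borel"
    and supp: "supported_within {-pi..pi} \<gamma>"
  shows "(\<integral>\<omega>. \<gamma> \<omega> * f \<omega> \<partial>band) = (\<integral>\<omega>. \<gamma> \<omega> * f \<omega> \<partial>lborel)"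
proof -
  have "(\<integral>\<omega>. \<gamma> \<omega> * f \<omega> \<partial>band) = (\<integral>\<omega>. indicator {-pi..pi} \<omega> *\<^sub>R (\<gamma> \<omega> * f \<omega>) \<partial>lborel)"
    by (rule integral_restrict_space) simp
  also have "\<dots> = (\<integral>\<omega>. \<gamma> \<omega> * f \<omega> \<partial>lborel)"
  proof (rule integral_cong_AE)
    show "AE \<omega> in lborel. indicator {-pi..pi} \<omega> *\<^sub>R (\<gamma> \<omega> * f \<omega>) = \<gamma> \<omega> * f \<omega>"
      using supp[unfolded supported_within_def] by eventually_elim (auto simp: indicator_def)
  qed measurable
  finally show ?thesis .
qed

text \<open>Stationarity bounds the autocorrelation, quadratic-mean continuity makes it continuous,
  and \<gamma> is integrable because it is bounded and lives on a bounded set; so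
  \<open>fourier_inversion\<close> applies. An identity for all \<open>t\<close> and
  \<open>s\<close> is required, since Riemann sums evaluate \<open>X\<close> at individual
  times.\<close>

lemma spectral_representation:
  assumes ws: "wide_sense_stationary P X" and qm: "continuous_in_quadratic_mean P X"
    and spec: "is_spectrum P X \<gamma>"
    and bd: "AE \<omega> in lborel. norm (\<gamma> \<omega>) \<le> C" and supp: "supported_within {-pi..pi} \<gamma>"
  shows "complex_of_real (\<integral>x. X t x * X s x \<partial>P)
      = 1 / (2 * pi) * (\<integral>\<omega>. \<gamma> \<omega> * exp (\<i> * of_real (\<omega> * (t - s))) \<partial>band)"
proof -
  have \<gamma> [measurable]: "\<gamma> \<in> borel_measurable borel"
    using spec by (simp add: is_spectrum_def has_fourier_transform_def square_integrable_def)
  have "continuous_on UNIV (autocorrelation P X)"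
    using ws qm by (intro continuous_autocorrelation) (auto simp: wide_sense_stationary_def)
  then have "continuous_on UNIV (\<lambda>t. complex_of_real (autocorrelation P X t))"
    by (intro continuous_intros)
  moreover have "norm (complex_of_real (autocorrelation P X t)) \<le> (l2norm P (X 0))\<^sup>2" for t
    using autocorrelation_bounded[OF ws] by simp
  ultimately have "complex_of_real (autocorrelation P X (t - s))
      = 1 / (2 * pi) * (\<integral>\<omega>. \<gamma> \<omega> * exp (\<i> * of_real (\<omega> * (t - s))) \<partial>lborel)"
    by (rule fourier_inversion[OF spec[unfolded is_spectrum_def]])
       (rule integrable_band_supported[OF \<gamma> bd supp])
  then show ?thesis
    unfolding autocorrelation_diff[OF ws] by (subst integral_band_supported[OF \<gamma> _ supp]) simp_all
qed

text \<open>Both \<open>c k\<close> and \<open>c 0\<close> are matched with phases times the same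
  \<Phi>. In the isometry the phases combine to the exponential at lag \<open>k\<close>, and \<Phi>
  meets its own conjugate, leaving the squared modulus.\<close>

lemma coefficient_autocorrelation:
  assumes ws: "wide_sense_stationary P X" and qm: "continuous_in_quadratic_mean P X"
    and spec: "is_spectrum P X \<gamma>"
    and bd: "AE \<omega> in lborel. norm (\<gamma> \<omega>) \<le> C" and supp: "supported_within {-pi..pi} \<gamma>"
    and w: "continuous_on UNIV w" and ft: "has_fourier_transform (\<lambda>t. of_real (w t)) \<Phi>"
    and c: "is_packet_coefficients P X M j w c"
  shows "complex_of_real (autocorrelation P c k) = 1 / (2 * pi) *
    (\<integral>\<omega>. \<gamma> \<omega> * exp (\<i> * of_real (\<omega> * (real (M ^ j) * of_int k))) * of_real ((norm (\<Phi> \<omega>))\<^sup>2) \<partial>band)"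
proof -
  let ?E = "\<lambda>k \<omega>. exp (- (\<i> * complex_of_real (\<omega> * (real (M ^ j) * of_int k))))"
  have X: "square_integrable P (X t)" for t
    using ws by (simp add: wide_sense_stationary_def second_order_def)
  have \<gamma>: "\<gamma> \<in> borel_measurable band"
    using spec by (auto simp: is_spectrum_def has_fourier_transform_def square_integrable_def
        intro: measurable_restrict_space1)
  have bd': "AE \<omega> in band. norm (\<gamma> \<omega>) \<le> C"
    using bd by (subst AE_restrict_space_iff) auto
  have pair: "spectral_pair P X (c k) (\<lambda>\<omega>. ?E k \<omega> * \<Phi> \<omega>)" for k
    using c by (intro spectral_pair_ms_integral_line[OF X w ft]) (simp add: is_packet_coefficients_def)
  have "complex_of_real (autocorrelation P c k)
      = 1 / (2 * pi) * (\<integral>\<omega>. (\<gamma> \<omega> * cnj (?E k \<omega> * \<Phi> \<omega>)) * (?E 0 \<omega> * \<Phi> \<omega>) \<partial>band)"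
    unfolding autocorrelation_def
    by (rule spectral_isometry[OF X \<gamma> bd' spectral_representation[OF ws qm spec bd supp] pair pair])
  also have "(\<integral>\<omega>. (\<gamma> \<omega> * cnj (?E k \<omega> * \<Phi> \<omega>)) * (?E 0 \<omega> * \<Phi> \<omega>) \<partial>band)
      = (\<integral>\<omega>. \<gamma> \<omega> * exp (\<i> * of_real (\<omega> * (real (M ^ j) * of_int k))) * of_real ((norm (\<Phi> \<omega>))\<^sup>2) \<partial>band)"
    by (intro Bochner_Integration.integral_cong refl)
       (simp add: exp_cnj complex_norm_square mult_ac del: of_real_power)
  finally show ?thesis .
qed

text \<open>Here \<open>e\<close> stands for the exponential at a given lag. Only its modulus 1
  enters, so the bound is free of the lag, which is the source of uniformity in
  \<open>k\<close>.\<close>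

lemma autocorrelation_diff_le:
  fixes R R' :: real and \<Phi> \<Psi> e :: "real \<Rightarrow> complex"
  assumes \<gamma>: "\<gamma> \<in> borel_measurable band" "AE \<omega> in band. norm (\<gamma> \<omega>) \<le> C"
    and e: "e \<in> borel_measurable band" "\<And>\<omega>. norm (e \<omega>) = 1"
    and \<Phi>: "square_integrable band \<Phi>" and \<Psi>: "square_integrable band \<Psi>"
    and R: "complex_of_real R = 1 / (2 * pi) * (\<integral>\<omega>. \<gamma> \<omega> * e \<omega> * of_real ((norm (\<Phi> \<omega>))\<^sup>2) \<partial>band)"
    and R': "complex_of_real R' = 1 / (2 * pi) * (\<integral>\<omega>. \<gamma> \<omega> * e \<omega> * of_real ((norm (\<Psi> \<omega>))\<^sup>2) \<partial>band)"
  shows "\<bar>R - R'\<bar> \<le> C / (2 * pi) * (\<integral>\<omega>. \<bar>(norm (\<Phi> \<omega>))\<^sup>2 - (norm (\<Psi> \<omega>))\<^sup>2\<bar> \<partial>band)"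
proof -
  have [measurable]: "\<gamma> \<in> borel_measurable band" "e \<in> borel_measurable band" by (fact \<gamma> e)+
  have int: "integrable band (\<lambda>\<omega>. \<gamma> \<omega> * e \<omega> * of_real (h \<omega>))"
    and le: "norm (\<integral>\<omega>. \<gamma> \<omega> * e \<omega> * of_real (h \<omega>) \<partial>band) \<le> C * (\<integral>\<omega>. \<bar>h \<omega>\<bar> \<partial>band)"
    if h: "integrable band h" for h :: "real \<Rightarrow> real"
  proof -
    have [measurable]: "h \<in> borel_measurable band" using h by auto
    have bd: "AE \<omega> in band. norm (\<gamma> \<omega> * e \<omega> * of_real (h \<omega>)) \<le> C * \<bar>h \<omega>\<bar>"
      using \<gamma>(2) by eventually_elim (simp add: norm_mult e mult_right_mono)
    have Ch: "integrable band (\<lambda>\<omega>. C * \<bar>h \<omega>\<bar>)" using h by simp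
    show "integrable band (\<lambda>\<omega>. \<gamma> \<omega> * e \<omega> * of_real (h \<omega>))"
      using bd by (intro Bochner_Integration.integrable_bound[OF Ch]) (auto elim!: eventually_mono)
    have "norm (\<integral>\<omega>. \<gamma> \<omega> * e \<omega> * of_real (h \<omega>) \<partial>band) \<le> (\<integral>\<omega>. C * \<bar>h \<omega>\<bar> \<partial>band)"
    proof (rule order_trans[OF integral_norm_bound integral_mono_AE])
      show "integrable band (\<lambda>\<omega>. norm (\<gamma> \<omega> * e \<omega> * of_real (h \<omega>)))"
        using bd by (intro Bochner_Integration.integrable_bound[OF Ch]) (auto elim!: eventually_mono)
    qed (use Ch bd in auto)
    then show "norm (\<integral>\<omega>. \<gamma> \<omega> * e \<omega> * of_real (h \<omega>) \<partial>band) \<le> C * (\<integral>\<omega>. \<bar>h \<omega>\<bar> \<partial>band)" by simp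
  qed
  have i: "integrable band (\<lambda>\<omega>. (norm (\<Phi> \<omega>))\<^sup>2)" "integrable band (\<lambda>\<omega>. (norm (\<Psi> \<omega>))\<^sup>2)"
    using \<Phi> \<Psi> by (auto simp: square_integrable_def)
  have "complex_of_real (R - R') = 1 / (2 * pi) *
      (\<integral>\<omega>. \<gamma> \<omega> * e \<omega> * of_real ((norm (\<Phi> \<omega>))\<^sup>2 - (norm (\<Psi> \<omega>))\<^sup>2) \<partial>band)"
    unfolding of_real_diff R R' right_diff_distrib[symmetric]
      Bochner_Integration.integral_diff[OF int[OF i(1)] int[OF i(2)], symmetric] ..
  then have "\<bar>R - R'\<bar> = 1 / (2 * pi) *
      norm (\<integral>\<omega>. \<gamma> \<omega> * e \<omega> * of_real ((norm (\<Phi> \<omega>))\<^sup>2 - (norm (\<Psi> \<omega>))\<^sup>2) \<partial>band)"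
    by (subst norm_of_real[symmetric, where 'a = complex]) (simp only: norm_mult norm_of_real, simp)
  also have "\<dots> \<le> 1 / (2 * pi) * (C * (\<integral>\<omega>. \<bar>(norm (\<Phi> \<omega>))\<^sup>2 - (norm (\<Psi> \<omega>))\<^sup>2\<bar> \<partial>band))"
    by (intro mult_left_mono le Bochner_Integration.integrable_diff i) simp
  finally show ?thesis by simp
qed

section \<open>Bounds and limits of the packet responses\<close>

text \<open>The diagonal entry (i, i) of U U* says that row \<open>i\<close> has Euclidean norm
  1.\<close>

lemma unitary_mat_entry_le_1:
  assumes U: "unitary_mat n U" and ij: "i < n" "j < n"
  shows "norm (U $$ (i, j)) \<le> 1"
proof -
  have dim: "U \<in> carrier_mat n n" using U by (simp add: unitary_mat_def)
  have "1 = (U * mat_adjoint U) $$ (i, i)" using U ij by (simp add: unitary_mat_def)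
  also have "\<dots> = (\<Sum>q<n. U $$ (i, q) * cnj (U $$ (i, q)))"
    using dim ij
    by (auto simp: mat_adjoint_def scalar_prod_def mat_of_rows_def atLeast0LessThan intro!: sum.cong)
  also have "\<dots> = complex_of_real (\<Sum>q<n. (norm (U $$ (i, q)))\<^sup>2)"
    by (simp add: complex_norm_square del: of_real_power)
  finally have "(\<Sum>q<n. (norm (U $$ (i, q)))\<^sup>2) = 1"
    by (metis of_real_eq_1_iff)
  moreover have "(norm (U $$ (i, j)))\<^sup>2 \<le> (\<Sum>q<n. (norm (U $$ (i, q)))\<^sup>2)"
    using ij by (intro member_le_sum) auto
  ultimately show ?thesis by (simp add: power2_le_iff_abs_le abs_square_le_1)
qed

lemma paraunitary_norm_le_1:
  assumes "paraunitary M H" and "m < M"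
  shows "AE \<omega> in lborel. norm (H m \<omega>) \<le> 1"
  using assms(1) unfolding paraunitary_def
proof eventually_elim
  case (elim \<omega>)
  \<comment> \<open>Column 0 of the polyphase-type matrix carries the shift 0, that is,
    \<open>H m \<omega>\<close> itself.\<close>
  from unitary_mat_entry_le_1[OF this, of m 0] show ?case using assms(2) by simp
qed

text \<open>A nonzero dilation pulls null sets back to null sets. \<open>Q\<close> need not be
  measurable, so the argument runs through a measurable null set \<open>N\<close> covering the
  exceptions.\<close>

lemma AE_lborel_scale:
  fixes a :: real
  assumes "a \<noteq> 0" and "AE x in lborel. Q x"
  shows "AE x in lborel. Q (a * x)"
proof -
  obtain N where N: "{x \<in> space lborel. \<not> Q x} \<subseteq> N" "N \<in> null_sets lborel"
    using assms(2) by (auto elim!: AE_E simp: null_sets_def)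
  then have [measurable]: "N \<in> sets borel" by (auto simp: null_sets_def)
  have "AE x in lborel. x \<notin> N" using N(2) by (rule AE_not_in)
  from AE_borel_affine[OF assms(1) _ this, of 0] have "AE x in lborel. a * x \<notin> N" by simp
  then show ?thesis by eventually_elim (use N(1) in auto)
qed

lemma packet_response_bounded:
  assumes M: "M > 0" and "\<And>m. m < M \<Longrightarrow> AE \<omega> in lborel. norm (H m \<omega>) \<le> 1"
  shows "AE \<omega> in lborel. norm (packet_response M H j n \<omega>) \<le> real M powr (real j / 2)"
proof -
  have "AE \<omega> in lborel. norm (H (packet_digit M j n l) (real (M ^ (l - 1)) * \<omega>)) \<le> 1" for l
    using M by (intro AE_lborel_scale[where Q = "\<lambda>\<omega>. norm (H _ \<omega>) \<le> 1"] assms packet_digit_less) auto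
  \<comment> \<open>Ranging over all \<open>l\<close> instead of 1..j is harmless: every digit is
    below \<open>M\<close>, every dilation factor is nonzero, and a countable union of null sets is
    null.\<close>
  then have "AE \<omega> in lborel. \<forall>l. norm (H (packet_digit M j n l) (real (M ^ (l - 1)) * \<omega>)) \<le> 1"
    by (simp add: AE_all_countable)
  then show ?thesis
  proof eventually_elim
    case (elim \<omega>)
    have "norm (\<Prod>l=1..j. H (packet_digit M j n l) (real (M ^ (l - 1)) * \<omega>)) \<le> 1"
      unfolding prod_norm[symmetric] using elim by (intro prod_le_1) auto
    then show ?case
      by (simp add: packet_response_def norm_mult indicator_def mult_left_le)
  qed
qed

lemma packet_response_tendsto:
  fixes H :: "nat \<Rightarrow> nat \<Rightarrow> real \<Rightarrow> complex"
  assumes M: "M > 0" and "\<And>m. m < M \<Longrightarrow> AE \<omega> in lborel. (\<lambda>r. H r m \<omega>) \<longlonglongrightarrow> H' m \<omega>"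
  shows "AE \<omega> in lborel. (\<lambda>r. packet_response M (H r) j n \<omega>) \<longlonglongrightarrow> packet_response M H' j n \<omega>"
proof -
  have "AE \<omega> in lborel. (\<lambda>r. H r (packet_digit M j n l) (real (M ^ (l - 1)) * \<omega>))
      \<longlonglongrightarrow> H' (packet_digit M j n l) (real (M ^ (l - 1)) * \<omega>)" for l
    using M by (intro AE_lborel_scale[where Q = "\<lambda>\<omega>. (\<lambda>r. H r _ \<omega>) \<longlonglongrightarrow> H' _ \<omega>"]
        assms packet_digit_less) auto
  then have "AE \<omega> in lborel. \<forall>l. (\<lambda>r. H r (packet_digit M j n l) (real (M ^ (l - 1)) * \<omega>))
      \<longlonglongrightarrow> H' (packet_digit M j n l) (real (M ^ (l - 1)) * \<omega>)"
    by (simp add: AE_all_countable)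
  then show ?thesis
  proof eventually_elim
    case (elim \<omega>)
    then show ?case
      unfolding packet_response_def by (intro tendsto_mult tendsto_const tendsto_prod) auto
  qed
qed

text \<open>Dominated convergence with the majorant
  \<open>K\<^sup>2 + (norm (\<Psi> \<omega>))\<^sup>2\<close>: the constant is integrable because
  the band is finite, the other term because the limit is square integrable.\<close>

lemma integral_band_abs_square_diff_tendsto_0:
  fixes \<Phi> :: "nat \<Rightarrow> real \<Rightarrow> complex"
  assumes \<Phi>: "\<And>r. square_integrable band (\<Phi> r)" and \<Psi>: "square_integrable band \<Psi>"
    and lim: "AE \<omega> in lborel. (\<lambda>r. \<Phi> r \<omega>) \<longlonglongrightarrow> \<Psi> \<omega>"
    and bd: "\<And>r. AE \<omega> in lborel. norm (\<Phi> r \<omega>) \<le> K"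
  shows "(\<lambda>r. \<integral>\<omega>. \<bar>(norm (\<Phi> r \<omega>))\<^sup>2 - (norm (\<Psi> \<omega>))\<^sup>2\<bar> \<partial>band) \<longlonglongrightarrow> 0"
proof -
  have [measurable]: "\<Phi> r \<in> borel_measurable band" "\<Psi> \<in> borel_measurable band" for r
    using \<Phi> \<Psi> by (auto simp: square_integrable_def)
  have "(\<lambda>r. \<integral>\<omega>. \<bar>(norm (\<Phi> r \<omega>))\<^sup>2 - (norm (\<Psi> \<omega>))\<^sup>2\<bar> \<partial>band) \<longlonglongrightarrow> (\<integral>\<omega>. 0 \<partial>band)"
  proof (rule integral_dominated_convergence[where w = "\<lambda>\<omega>. K\<^sup>2 + (norm (\<Psi> \<omega>))\<^sup>2"])
    have "integrable band (\<lambda>\<omega>. K\<^sup>2)" by (rule integrable_band_bounded) auto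
    then show "integrable band (\<lambda>\<omega>. K\<^sup>2 + (norm (\<Psi> \<omega>))\<^sup>2)"
      using \<Psi> by (auto simp: square_integrable_def)
    have "AE \<omega> in band. (\<lambda>r. \<Phi> r \<omega>) \<longlonglongrightarrow> \<Psi> \<omega>"
      using lim by (subst AE_restrict_space_iff) auto
    then show "AE \<omega> in band. (\<lambda>r. \<bar>(norm (\<Phi> r \<omega>))\<^sup>2 - (norm (\<Psi> \<omega>))\<^sup>2\<bar>) \<longlonglongrightarrow> 0"
    proof eventually_elim
      case (elim \<omega>)
      then have "(\<lambda>r. \<bar>(norm (\<Phi> r \<omega>))\<^sup>2 - (norm (\<Psi> \<omega>))\<^sup>2\<bar>) \<longlonglongrightarrow> \<bar>(norm (\<Psi> \<omega>))\<^sup>2 - (norm (\<Psi> \<omega>))\<^sup>2\<bar>"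
        by (intro tendsto_intros)
      then show ?case by simp
    qed
    fix r
    have "AE \<omega> in band. norm (\<Phi> r \<omega>) \<le> K"
      using bd[of r] by (subst AE_restrict_space_iff) auto
    then show "AE \<omega> in band. norm \<bar>(norm (\<Phi> r \<omega>))\<^sup>2 - (norm (\<Psi> \<omega>))\<^sup>2\<bar> \<le> K\<^sup>2 + (norm (\<Psi> \<omega>))\<^sup>2"
    proof eventually_elim
      case (elim \<omega>)
      then have "(norm (\<Phi> r \<omega>))\<^sup>2 \<le> K\<^sup>2" by (intro power_mono) auto
      moreover have "0 \<le> (norm (\<Phi> r \<omega>))\<^sup>2" "0 \<le> (norm (\<Psi> \<omega>))\<^sup>2" by auto
      ultimately show ?case unfolding real_norm_def by linarith
    qed
  qed measurable
  then show ?thesis by simp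
qed

section \<open>Uniform convergence of the autocorrelation functions\<close>

theorem theorem2:
  fixes P :: "'a measure"
    and X :: "real \<Rightarrow> 'a \<Rightarrow> real"
    and \<gamma> :: "real \<Rightarrow> complex"
    and M :: nat
    and h :: "nat \<Rightarrow> nat \<Rightarrow> int \<Rightarrow> real"
    and H :: "nat \<Rightarrow> nat \<Rightarrow> real \<Rightarrow> complex"
    and W :: "nat \<Rightarrow> nat \<Rightarrow> nat \<Rightarrow> real \<Rightarrow> real"
    and WS :: "nat \<Rightarrow> nat \<Rightarrow> real \<Rightarrow> real"
    and c :: "nat \<Rightarrow> nat \<Rightarrow> nat \<Rightarrow> int \<Rightarrow> 'a \<Rightarrow> real"
    and cS :: "nat \<Rightarrow> nat \<Rightarrow> int \<Rightarrow> 'a \<Rightarrow> real"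
  assumes "M \<ge> 2"
    and "prob_space P"
    and "second_order P X"
    and "centred P X"
    and "wide_sense_stationary P X"
    and "continuous_in_quadratic_mean P X"
    and "is_spectrum P X \<gamma>"
    and "essentially_bounded \<gamma>"
    and "supported_within {-pi..pi} \<gamma>"
    and "\<And>r m. m < M \<Longrightarrow> has_frequency_response M (h r m) (H r m)"
    and "\<And>r. paraunitary M (H r)"
    and "\<And>m. m < M \<Longrightarrow>
           AE \<omega> in lborel. (\<lambda>r. H r m \<omega>) \<longlonglongrightarrow> shannon_response M m \<omega>"
    and "\<And>r j n. n < M ^ j \<Longrightarrow> is_wavelet_packet M (H r) j n (W r j n)"
    and "\<And>j n. n < M ^ j \<Longrightarrow> is_wavelet_packet M (shannon_response M) j n (WS j n)"
    and "\<And>r j n. n < M ^ j \<Longrightarrow> is_packet_coefficients P X M j (W r j n) (c r j n)"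
    and "\<And>j n. n < M ^ j \<Longrightarrow> is_packet_coefficients P X M j (WS j n) (cS j n)"
  shows "\<forall>j. uniform_limit (UNIV \<times> {..<M ^ j})
           (\<lambda>r (k, n). autocorrelation P (c r j n) k)
           (\<lambda>(k, n). autocorrelation P (cS j n) k)
           sequentially"
proof
  fix j
  obtain C where C: "AE \<omega> in lborel. norm (\<gamma> \<omega>) \<le> C"
    using assms(8) by (auto simp: essentially_bounded_def)
  have \<gamma>: "\<gamma> \<in> borel_measurable band" "AE \<omega> in band. norm (\<gamma> \<omega>) \<le> C"
    using assms(8) C by (auto simp: essentially_bounded_def AE_restrict_space_iff
        intro!: measurable_restrict_space1)
  \<comment> \<open>This L1 distance depends on the node and the order but not on the lag.\<close>
  let ?D = "\<lambda>n r. \<integral>\<omega>. \<bar>(norm (packet_response M (H r) j n \<omega>))\<^sup>2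
    - (norm (packet_response M (shannon_response M) j n \<omega>))\<^sup>2\<bar> \<partial>band"
  have bound: "\<bar>autocorrelation P (c r j n) k - autocorrelation P (cS j n) k\<bar> \<le> C / (2 * pi) * ?D n r"
    if n: "n < M ^ j" for r n k
  proof -
    note W = assms(13)[OF n, of r, unfolded is_wavelet_packet_def]
      and WS = assms(14)[OF n, unfolded is_wavelet_packet_def]
    note coefficients = coefficient_autocorrelation[OF assms(5,6,7) C assms(9)]
    show ?thesis
    proof (rule autocorrelation_diff_le[OF \<gamma>])
      show "square_integrable band (packet_response M (H r) j n)"
        "square_integrable band (packet_response M (shannon_response M) j n)"
        using W WS by (auto simp: has_fourier_transform_def intro!: square_integrable_band)
      show "(\<lambda>\<omega>. exp (\<i> * complex_of_real (\<omega> * (real (M ^ j) * of_int k)))) \<in> borel_measurable band"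
        by (intro measurable_restrict_space1) measurable
    qed (simp, rule coefficients[OF conjunct1[OF W] conjunct2[OF W] assms(15)[OF n]],
        rule coefficients[OF conjunct1[OF WS] conjunct2[OF WS] assms(16)[OF n]])
  qed
  have D: "?D n \<longlonglongrightarrow> 0" if n: "n < M ^ j" for n
  proof (rule integral_band_abs_square_diff_tendsto_0)
    show "square_integrable band (packet_response M (H r) j n)" for r
      using assms(13)[OF n] by (auto simp: is_wavelet_packet_def has_fourier_transform_def intro!: square_integrable_band)
    show "square_integrable band (packet_response M (shannon_response M) j n)"
      using assms(14)[OF n] by (auto simp: is_wavelet_packet_def has_fourier_transform_def intro!: square_integrable_band)
    show "AE \<omega> in lborel. (\<lambda>r. packet_response M (H r) j n \<omega>)
        \<longlonglongrightarrow> packet_response M (shannon_response M) j n \<omega>"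
      using assms(1,12) by (intro packet_response_tendsto) auto
    show "AE \<omega> in lborel. norm (packet_response M (H r) j n \<omega>) \<le> real M powr (real j / 2)" for r
      using assms(1,11) by (intro packet_response_bounded paraunitary_norm_le_1) auto
  qed
  show "uniform_limit (UNIV \<times> {..<M ^ j})
      (\<lambda>r (k, n). autocorrelation P (c r j n) k) (\<lambda>(k, n). autocorrelation P (cS j n) k) sequentially"
    unfolding uniform_limit_iff
  proof (intro allI impI)
    fix e :: real assume "e > 0"
    \<comment> \<open>Uniformity in \<open>n\<close> comes from the finiteness of the set of nodes
      at the fixed depth \<open>j\<close>: finitely many eventual bounds hold simultaneously from
      some order on.\<close>
    have "eventually (\<lambda>r. \<forall>n\<in>{..<M ^ j}. C / (2 * pi) * ?D n r < e) sequentially"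
    proof (intro eventually_ball_finite ballI)
      fix n assume "n \<in> {..<M ^ j}"
      then have "(\<lambda>r. C / (2 * pi) * ?D n r) \<longlonglongrightarrow> C / (2 * pi) * 0"
        by (intro tendsto_mult tendsto_const D) simp
      then show "eventually (\<lambda>r. C / (2 * pi) * ?D n r < e) sequentially"
        using \<open>e > 0\<close> by (intro order_tendstoD(2)[where y = "C / (2 * pi) * 0"]) auto
    qed simp
    then show "eventually (\<lambda>r. \<forall>x\<in>UNIV \<times> {..<M ^ j}.
        dist (case x of (k, n) \<Rightarrow> autocorrelation P (c r j n) k)
             (case x of (k, n) \<Rightarrow> autocorrelation P (cS j n) k) < e) sequentially"
    proof eventually_elim
      case (elim r)
      then show ?case using bound by (fastforce simp: dist_real_def intro: le_less_trans)
    qed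
  qed
qed

end
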